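(* Let $F$ be a field of characteristic $0$ and let $UT_2(F)$ be equipped with the elementary $\mathbb{Z}_2$-grading induced by the pair $\phi=(0,0)$. Then for every $n\geq 2$ the $n$-th $Y$-proper graded cocharacter and codimension of $UT_2(F)$ are $$\xi_n^{\mathbb{Z}_2}(UT_2(F))=[(n-1,1)]\qquad\text{and}\qquad \gamma_n^{\mathbb{Z}_2}(UT_2(F))=n-1.$$
   Context: $UT_2(F)$ is the algebra of $2\times 2$ upper-triangular matrices over $F$. With the grading induced by $\phi=(0,0)$ every matrix unit has degree $0\in\mathbb{Z}_2$, so $UT_2(F)$ is concentrated in degree $0$. Let $G=\mathbb{Z}_2$ and let $F\langle X\mid G\rangle$ be the free associative unitary algebra on variables $x_i^{g}$ ($i\ge 1$, $g\in G$), where $x_i^g$ has degree $g$. Let $Y$ be the set of variables of degree $0$ and $Z$ the set of the remaining variables. For a $G$-graded algebra $A$, $T_G(A)$ is the ideal of graded polynomial identities of $A$, i.e. of the polynomials vanishing under all substitutions of each variable by a homogeneous element of $A$ of the same degree. A polynomial is $Y$-proper if it lies in the unitary subalgebra generated by $Z$ and all commutators of length at least two in the variables. Let $P_n^G$ be the span of all monomials $x_{\sigma(1)}^{g_1}\cdots x_{\sigma(n)}^{g_n}$ with $\sigma\in S_n$ and $g_1,\ldots,g_n\in G$, with $S_n$ acting on the left by permuting the lower indices, and let $\Gamma_n^G\subseteq P_n^G$ be the $S_n$-submodule of $Y$-proper polynomials. Then $\xi_n^G(A)$ and $\gamma_n^G(A)$ denote respectively the $S_n$-character and the dimension over $F$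 of $\Gamma_n^G/(\Gamma_n^G\cap T_G(A))$. For a partition $\lambda\vdash n$, $[\lambda]$ is the associated irreducible character of $S_n$. *)

theory Defs
  imports
    "HOL-Analysis.Cartesian_Space"
    "HOL-Library.Poly_Mapping"
    "HOL-Library.Z2"
    "HOL-Combinatorics.Permutations"
begin

text \<open>Linear algebra on finitely supported functions, used both for the free algebra and for the
  group algebra of the symmetric group.\<close>

definition pm_scale :: "'a::field \<Rightarrow> ('k \<Rightarrow>\<^sub>0 'a) \<Rightarrow> ('k \<Rightarrow>\<^sub>0 'a)" where
  "pm_scale c p = Poly_Mapping.map ((*) c) p"

lemma lookup_pm_scale: "Poly_Mapping.lookup (pm_scale c p) k = c * Poly_Mapping.lookup p k"
  unfolding pm_scale_def by transfer (simp add: when_def)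

global_interpretation pm: vector_space "pm_scale :: 'a::field \<Rightarrow> ('k \<Rightarrow>\<^sub>0 'a) \<Rightarrow> ('k \<Rightarrow>\<^sub>0 'a)"
  by unfold_locales
    (auto intro!: poly_mapping_eqI simp: lookup_pm_scale lookup_add algebra_simps)

text \<open>The linear map sending each basis element \<open>k\<close> to the basis element \<open>h k\<close>.\<close>

definition pm_push :: "('k \<Rightarrow> 'l) \<Rightarrow> ('k \<Rightarrow>\<^sub>0 'a::field) \<Rightarrow> ('l \<Rightarrow>\<^sub>0 'a)" where
  "pm_push h p = (\<Sum>k\<in>Poly_Mapping.keys p. Poly_Mapping.single (h k) (Poly_Mapping.lookup p k))"

text \<open>For subspaces \<open>W \<subseteq> V\<close>, a basis of the quotient \<open>V / W\<close> is given by representatives in \<open>V\<close>: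
  every class \<open>v + W\<close> is \<open>\<Sum>b\<in>B. c b (b + W)\<close> for exactly one coefficient family \<open>c\<close>.\<close>

definition quot_coords ::
    "('k \<Rightarrow>\<^sub>0 'a::field) set \<Rightarrow> ('k \<Rightarrow>\<^sub>0 'a) set \<Rightarrow> ('k \<Rightarrow>\<^sub>0 'a) \<Rightarrow> (('k \<Rightarrow>\<^sub>0 'a) \<Rightarrow> 'a) \<Rightarrow> bool" where
  "quot_coords W B v c \<longleftrightarrow>
     (\<forall>b. b \<notin> B \<longrightarrow> c b = 0) \<and> v - (\<Sum>b\<in>B. pm_scale (c b) b) \<in> W"

definition quot_basis ::
    "('k \<Rightarrow>\<^sub>0 'a::field) set \<Rightarrow> ('k \<Rightarrow>\<^sub>0 'a) set \<Rightarrow> ('k \<Rightarrow>\<^sub>0 'a) set \<Rightarrow> bool" where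
  "quot_basis V W B \<longleftrightarrow> finite B \<and> B \<subseteq> V \<and> (\<forall>v\<in>V. \<exists>!c. quot_coords W B v c)"

definition quot_dim :: "('k \<Rightarrow>\<^sub>0 'a::field) set \<Rightarrow> ('k \<Rightarrow>\<^sub>0 'a) set \<Rightarrow> nat" where
  "quot_dim V W = (if \<exists>B. quot_basis V W B then card (SOME B. quot_basis V W B) else 0)"

text \<open>The trace of the endomorphism of \<open>V / W\<close> induced by a linear map \<open>f\<close> that maps \<open>V\<close> to \<open>V\<close> and
  \<open>W\<close> to \<open>W\<close>.\<close>

definition quot_trace ::
    "('k \<Rightarrow>\<^sub>0 'a::field) set \<Rightarrow> ('k \<Rightarrow>\<^sub>0 'a) set \<Rightarrow> (('k \<Rightarrow>\<^sub>0 'a) \<Rightarrow> ('k \<Rightarrow>\<^sub>0 'a)) \<Rightarrow> 'a" where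
  "quot_trace V W f =
     (if \<exists>B. quot_basis V W B
      then let B = (SOME B. quot_basis V W B) in \<Sum>b\<in>B. (THE c. quot_coords W B (f b) c) b
      else 0)"


text \<open>The free monoid on \<open>'v\<close>, written additively so that \<open>'v word \<Rightarrow>\<^sub>0 'a\<close> with the convolution
  product of \<^theory>\<open>HOL-Library.Poly_Mapping\<close> is the free associative unitary algebra on \<open>'v\<close>.\<close>

datatype 'v "word" = Word (letters: "'v list")

instantiation "word" :: (type) monoid_add
begin

definition zero_word :: "'a word" where "0 = Word []"

definition plus_word :: "'a word \<Rightarrow> 'a word \<Rightarrow> 'a word" where
  "u + v = Word (letters u @ letters v)"

instance
  by standard (simp_all add: zero_word_def plus_word_def)

end

text \<open>The pair \<open>(i, g)\<close> is the variable of degree \<open>g\<close> with lower index \<open>i + 1\<close>; accordingly the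
  symmetric group of degree \<open>n\<close> acts on \<open>{..<n}\<close>.\<close>

type_synonym ('g, 'a) free_alg = "(nat \<times> 'g) word \<Rightarrow>\<^sub>0 'a"

definition Var :: "nat \<times> 'g \<Rightarrow> ('g, 'a::field) free_alg" where
  "Var x = Poly_Mapping.single (Word [x]) 1"

definition commutator :: "'r::ring \<Rightarrow> 'r \<Rightarrow> 'r" where
  "commutator p q = p * q - q * p"

text \<open>Left-normed commutators \<open>[x\<^sub>1, x\<^sub>2, \<dots>, x\<^sub>k]\<close> with \<open>k \<ge> 2\<close> in the variables.\<close>

definition commutators :: "('g, 'a::field) free_alg set" where
  "commutators =
     {foldl (\<lambda>p y. commutator p (Var y)) (Var x) ys | x ys. ys \<noteq> []}"

inductive_set unitary_subalgebra ::
    "('g, 'a::field) free_alg set \<Rightarrow> ('g, 'a) free_alg set" for S where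
  one: "1 \<in> unitary_subalgebra S"
| gen: "p \<in> S \<Longrightarrow> p \<in> unitary_subalgebra S"
| scale: "p \<in> unitary_subalgebra S \<Longrightarrow> pm_scale c p \<in> unitary_subalgebra S"
| add: "p \<in> unitary_subalgebra S \<Longrightarrow> q \<in> unitary_subalgebra S \<Longrightarrow> p + q \<in> unitary_subalgebra S"
| mult: "p \<in> unitary_subalgebra S \<Longrightarrow> q \<in> unitary_subalgebra S \<Longrightarrow> p * q \<in> unitary_subalgebra S"

definition Y_proper :: "('g::zero, 'a::field) free_alg set" where
  "Y_proper = unitary_subalgebra ({Var (i, g) | i g. g \<noteq> 0} \<union> commutators)"

definition multilinear :: "nat \<Rightarrow> ('g, 'a::field) free_alg set" where
  "multilinear n =
     pm.span {Poly_Mapping.single (Word (map (\<lambda>k. (\<sigma> k, g k)) [0..<n])) 1 | \<sigma> g. \<sigma> permutes {..<n}}"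

definition proper_multilinear :: "nat \<Rightarrow> ('g::zero, 'a::field) free_alg set" where
  "proper_multilinear n = multilinear n \<inter> Y_proper"

definition perm_act :: "(nat \<Rightarrow> nat) \<Rightarrow> ('g, 'a::field) free_alg \<Rightarrow> ('g, 'a) free_alg" where
  "perm_act \<sigma> = pm_push (\<lambda>w. Word (map (\<lambda>(i, g). (\<sigma> i, g)) (letters w)))"


text \<open>A graded (unitary) subalgebra of a full matrix algebra is given by its family \<open>A\<close> of
  homogeneous components.  The product of matrices is \<open>**\<close>; \<open>mat c\<close> is the scalar matrix.\<close>

definition eval_free ::
    "(nat \<times> 'g \<Rightarrow> 'a^'d^'d) \<Rightarrow> ('g, 'a::field) free_alg \<Rightarrow> 'a^'d^'d" where
  "eval_free s p =
     (\<Sum>w\<in>Poly_Mapping.keys p.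
        mat (Poly_Mapping.lookup p w) ** foldr (\<lambda>x M. s x ** M) (letters w) (mat 1))"

definition graded_identities ::
    "('g \<Rightarrow> ('a::field^'d^'d) set) \<Rightarrow> ('g, 'a) free_alg set" where
  "graded_identities A = {p. \<forall>s. (\<forall>i g. s (i, g) \<in> A g) \<longrightarrow> eval_free s p = 0}"

definition proper_codimension :: "('g::zero \<Rightarrow> ('a::field^'d^'d) set) \<Rightarrow> nat \<Rightarrow> nat" where
  "proper_codimension A n =
     quot_dim (proper_multilinear n) (proper_multilinear n \<inter> graded_identities A)"

text \<open>Characters of the symmetric group on \<open>{..<n}\<close> are extended by \<open>0\<close> to all functions on \<open>nat\<close>.\<close>

definition proper_cocharacter ::
    "('g::zero \<Rightarrow> ('a::field^'d^'d) set) \<Rightarrow> nat \<Rightarrow> (nat \<Rightarrow> nat) \<Rightarrow> 'a" where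
  "proper_cocharacter A n \<sigma> =
     (if \<sigma> permutes {..<n}
      then quot_trace (proper_multilinear n) (proper_multilinear n \<inter> graded_identities A) (perm_act \<sigma>)
      else 0)"

text \<open>The elementary grading of the upper-triangular matrices: the component of degree \<open>g\<close> is spanned
  by the matrix units \<open>e\<^sub>i\<^sub>j\<close>, \<open>i \<le> j\<close>, with \<open>- \<phi>\<^sub>i + \<phi>\<^sub>j = g\<close>.\<close>

definition UT2 :: "'g::group_add^2 \<Rightarrow> 'g \<Rightarrow> ('a::field^2^2) set" where
  "UT2 \<phi> g = {M. M $ 2 $ 1 = 0 \<and> (\<forall>i j. M $ i $ j \<noteq> 0 \<longrightarrow> - (\<phi> $ i) + \<phi> $ j = g)}"


text \<open>A partition is the weakly decreasing list \<open>\<mu>\<close> of its positive parts.  Its diagram is filled with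
  \<open>0, 1, 2, \<dots>\<close> along the rows.\<close>

definition tableau :: "nat list \<Rightarrow> nat \<Rightarrow> nat \<Rightarrow> nat" where
  "tableau \<mu> i j = sum_list (take i \<mu>) + j"

definition row_stabilizer :: "nat list \<Rightarrow> (nat \<Rightarrow> nat) set" where
  "row_stabilizer \<mu> =
     {p. p permutes {..<sum_list \<mu>} \<and>
         (\<forall>i<length \<mu>. p ` {tableau \<mu> i j | j. j < \<mu> ! i} = {tableau \<mu> i j | j. j < \<mu> ! i})}"

definition column_stabilizer :: "nat list \<Rightarrow> (nat \<Rightarrow> nat) set" where
  "column_stabilizer \<mu> =
     {q. q permutes {..<sum_list \<mu>} \<and>
         (\<forall>j. q ` {tableau \<mu> i j | i. i < length \<mu> \<and> j < \<mu> ! i} =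
              {tableau \<mu> i j | i. i < length \<mu> \<and> j < \<mu> ! i})}"

text \<open>The Young symmetrizer \<open>(\<Sum>q\<in>C. sign q q) (\<Sum>p\<in>R. p)\<close> in the group algebra, and the left ideal it
  generates.  This is the Specht module: the tabloid of a tableau corresponds to its row sum.\<close>

definition young_symmetrizer :: "nat list \<Rightarrow> ((nat \<Rightarrow> nat) \<Rightarrow>\<^sub>0 'a::field)" where
  "young_symmetrizer \<mu> =
     (\<Sum>q\<in>column_stabilizer \<mu>. \<Sum>p\<in>row_stabilizer \<mu>. Poly_Mapping.single (q \<circ> p) (of_int (sign q)))"

definition specht_module :: "nat list \<Rightarrow> ((nat \<Rightarrow> nat) \<Rightarrow>\<^sub>0 'a::field) set" where
  "specht_module \<mu> =
     pm.span {pm_push ((\<circ>) \<sigma>) (young_symmetrizer \<mu>) | \<sigma>. \<sigma> permutes {..<sum_list \<mu>}}"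

definition irreducible_character :: "nat list \<Rightarrow> (nat \<Rightarrow> nat) \<Rightarrow> 'a::field" where
  "irreducible_character \<mu> \<sigma> =
     (if \<sigma> permutes {..<sum_list \<mu>}
      then quot_trace (specht_module \<mu>) {0} (pm_push ((\<circ>) \<sigma>))
      else 0)"

end

theory Submission
  imports Defs
begin

text \<open>For \<open>p\<close> multilinear and \<open>Y\<close>-proper let \<open>e\<^sub>i(p)\<close> be the sum of the coefficients in \<open>p\<close> of the monomials
  in variables of degree \<open>0\<close> that end with \<open>x\<^sub>i\<close>. A \<open>Y\<close>-proper polynomial does not see scalar summands of the
  variables of degree \<open>0\<close>, so it may be evaluated at upper triangular matrices with second row \<open>0\<close>;
  the value is then \<open>(\<Sum>i. e\<^sub>i(p) b\<^sub>i \<Prod>j\<noteq>i. a\<^sub>j) e\<^sub>1\<^sub>2\<close> for the first rows \<open>(a\<^sub>i, b\<^sub>i)\<close>. Hence \<open>e\<close> identifies the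
  quotient with the vectors in \<open>F\<^sup>n\<close> of coordinate sum \<open>0\<close>, equivariantly under the symmetric group. The
  Specht module of \<open>(n - 1, 1)\<close> is identified with the same space: its elements are constant on
  the cosets of the stabilizer of the last point.\<close>

section \<open>Traces and dimensions of quotients\<close>

abbreviation pm_linear :: "(('k \<Rightarrow>\<^sub>0 'a::field) \<Rightarrow> ('l \<Rightarrow>\<^sub>0 'a)) \<Rightarrow> bool" where
  "pm_linear \<equiv> Vector_Spaces.linear pm_scale pm_scale"

lemma pm_linearI:
  assumes "\<And>p q. T (p + q) = T p + T q" "\<And>c p. T (pm_scale c p) = pm_scale c (T p)"
  shows "pm_linear T"
  using assms by unfold_locales auto

text \<open>A basis of V / W as an indexed family with explicit coordinate functions. In contrast to
  \<open>quot_basis\<close>, coordinates are given and not merely asserted to exist uniquely, so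
  traces and dimensions can be computed from them.\<close>

definition quot_family ::
    "('k \<Rightarrow>\<^sub>0 'a::field) set \<Rightarrow> ('k \<Rightarrow>\<^sub>0 'a) set \<Rightarrow> 'i set \<Rightarrow> ('i \<Rightarrow> ('k \<Rightarrow>\<^sub>0 'a)) \<Rightarrow>
      (('k \<Rightarrow>\<^sub>0 'a) \<Rightarrow> 'i \<Rightarrow> 'a) \<Rightarrow> bool" where
  "quot_family V W I u coord \<longleftrightarrow> finite I \<and> u ` I \<subseteq> V \<and>
     (\<forall>v\<in>V. v - (\<Sum>i\<in>I. pm_scale (coord v i) (u i)) \<in> W) \<and>
     (\<forall>d. (\<Sum>i\<in>I. pm_scale (d i) (u i)) \<in> W \<longrightarrow> (\<forall>i\<in>I. d i = 0))"

lemma quot_family_quot_basis: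
  fixes V W :: "('k \<Rightarrow>\<^sub>0 'a::field) set"
  assumes fam: "quot_family V W I u coord" and W: "pm.subspace W"
  shows "quot_basis V W (u ` I)"
proof -
  have fin: "finite I" and uV: "u ` I \<subseteq> V"
    and co: "\<And>v. v \<in> V \<Longrightarrow> v - (\<Sum>i\<in>I. pm_scale (coord v i) (u i)) \<in> W"
    and ind: "\<And>d. (\<Sum>i\<in>I. pm_scale (d i) (u i)) \<in> W \<Longrightarrow> \<forall>i\<in>I. d i = 0"
    using fam unfolding quot_family_def by blast+
  have inj: "inj_on u I"
  proof (rule inj_onI, rule ccontr)
    fix i j assume ij: "i \<in> I" "j \<in> I" "u i = u j" "i \<noteq> j"
    \<comment> \<open>\<open>quot_basis\<close> speaks of sets, so \<open>u\<close> must be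
      injective: a repetition \<open>u i = u j\<close> would give the nontrivial relation
      \<open>u i - u j = 0\<close>.\<close>
    let ?d = "\<lambda>k. if k = i then 1 else if k = j then -1 else (0::'a)"
    have "(\<Sum>k\<in>I. pm_scale (?d k) (u k)) = (\<Sum>k\<in>{i,j}. pm_scale (?d k) (u k))"
      by (rule sum.mono_neutral_right) (use fin ij in auto)
    also have "\<dots> = 0" using ij by simp
    finally have "\<forall>k\<in>I. ?d k = 0" using ind[of ?d] pm.subspace_0[OF W] by simp
    thus False using ij by auto
  qed
  have reindex: "(\<Sum>b\<in>u ` I. pm_scale (c b) b) = (\<Sum>i\<in>I. pm_scale (c (u i)) (u i))" for c
    by (simp add: sum.reindex[OF inj])
  show ?thesis
    unfolding quot_basis_def
  proof (intro conjI ballI)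
    fix v assume v: "v \<in> V"
    show "\<exists>!c. quot_coords W (u ` I) v c"
    proof (rule ex1I)
      show "quot_coords W (u ` I) v (\<lambda>b. if b \<in> u ` I then coord v (inv_into I u b) else 0)"
        unfolding quot_coords_def reindex using co[OF v] inj by simp
    next
      fix c assume c: "quot_coords W (u ` I) v c"
      have "(v - (\<Sum>i\<in>I. pm_scale (coord v i) (u i))) - (v - (\<Sum>i\<in>I. pm_scale (c (u i)) (u i))) \<in> W"
        using pm.subspace_diff[OF W co[OF v]] c unfolding quot_coords_def reindex by blast
      hence "(\<Sum>i\<in>I. pm_scale (c (u i) - coord v i) (u i)) \<in> W"
        by (simp add: pm.scale_left_diff_distrib sum_subtractf)
      from ind[OF this] have "\<forall>i\<in>I. c (u i) = coord v i" by simp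
      thus "c = (\<lambda>b. if b \<in> u ` I then coord v (inv_into I u b) else 0)"
        using c inj unfolding quot_coords_def by (intro ext) auto
    qed
  qed (use fin uV in auto)
qed

text \<open>Invariance of the trace as tr(PQ) = tr(QP), where P has the entries
  \<open>coord (f b) i\<close> and Q the entries \<open>c (u i) b\<close>: PQ is the matrix of
  \<open>f\<close> with respect to \<open>B\<close>, and QP the one with respect to
  \<open>u\<close>. This frees \<open>quot_trace\<close> from the basis picked by
  \<open>SOME\<close>.\<close>

lemma quot_basis_trace_eq:
  assumes fam: "quot_family V W I u coord" and W: "pm.subspace W"
    and B: "quot_basis V W B"
    and f: "pm_linear f" "f ` V \<subseteq> V" "f ` W \<subseteq> W"
  shows "(\<Sum>b\<in>B. (THE c. quot_coords W B (f b) c) b) = (\<Sum>i\<in>I. coord (f (u i)) i)"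
proof -
  interpret f: Vector_Spaces.linear pm_scale pm_scale f by (fact f(1))
  have uV: "\<And>i. i \<in> I \<Longrightarrow> u i \<in> V"
    and co: "\<And>v. v \<in> V \<Longrightarrow> v - (\<Sum>i\<in>I. pm_scale (coord v i) (u i)) \<in> W"
    and ind: "\<And>d. (\<Sum>i\<in>I. pm_scale (d i) (u i)) \<in> W \<Longrightarrow> \<forall>i\<in>I. d i = 0"
    using fam unfolding quot_family_def by blast+
  define c where "c v = (THE c. quot_coords W B v c)" for v
  have BV: "\<And>b. b \<in> B \<Longrightarrow> b \<in> V"
    and ex1: "\<And>v. v \<in> V \<Longrightarrow> \<exists>!c. quot_coords W B v c"
    using B unfolding quot_basis_def by auto
  have c: "quot_coords W B v (c v)" if "v \<in> V" for v
    unfolding c_def by (rule theI'[OF ex1[OF that]])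
  have cW: "v - (\<Sum>b\<in>B. pm_scale (c v b) b) \<in> W" if "v \<in> V" for v
    using c[OF that] unfolding quot_coords_def by simp
  \<comment> \<open>Expanding v in the \<open>u i\<close>, and each \<open>u i\<close> in
    \<open>B\<close>, yields admissible coefficients; uniqueness identifies them with
    \<open>c v\<close>. This gives the diagonal of PQ.\<close>
  have c_eq: "c v = (\<lambda>b. \<Sum>i\<in>I. coord v i * c (u i) b)" if v: "v \<in> V" for v
  proof -
    have "(\<Sum>b\<in>B. pm_scale (\<Sum>i\<in>I. coord v i * c (u i) b) b)
        = (\<Sum>i\<in>I. pm_scale (coord v i) (\<Sum>b\<in>B. pm_scale (c (u i) b) b))"
      by (simp add: pm.scale_sum_left pm.scale_sum_right sum.swap[of _ I B])
    hence "v - (\<Sum>b\<in>B. pm_scale (\<Sum>i\<in>I. coord v i * c (u i) b) b)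
        = (v - (\<Sum>i\<in>I. pm_scale (coord v i) (u i)))
          + (\<Sum>i\<in>I. pm_scale (coord v i) (u i - (\<Sum>b\<in>B. pm_scale (c (u i) b) b)))"
      by (simp add: pm.scale_right_diff_distrib sum_subtractf)
    also have "\<dots> \<in> W"
      by (intro pm.subspace_add[OF W] co[OF v] pm.subspace_sum[OF W] pm.subspace_scale[OF W] cW uV)
    finally have "quot_coords W B v (\<lambda>b. \<Sum>i\<in>I. coord v i * c (u i) b)"
      using c[OF uV] unfolding quot_coords_def by (auto intro!: sum.neutral)
    thus ?thesis using ex1[OF v] c[OF v] by blast
  qed
  \<comment> \<open>The diagonal of QP: \<open>f\<close> is applied to the expansion of
    \<open>u i\<close> in \<open>B\<close>, the error term staying in W because \<open>f\<close>
    preserves W, and the result is compared with the expansion of \<open>f (u i)\<close> by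
    independence.\<close>
  have chi: "coord (f (u i)) i = (\<Sum>b\<in>B. c (u i) b * coord (f b) i)" if i: "i \<in> I" for i
  proof -
    have fV: "f v \<in> V" if "v \<in> V" for v using f(2) that by blast
    have 1: "f (u i) - (\<Sum>b\<in>B. pm_scale (c (u i) b) (f b)) \<in> W"
    proof -
      have "f (u i - (\<Sum>b\<in>B. pm_scale (c (u i) b) b)) \<in> W"
        using cW[OF uV[OF i]] f(3) by blast
      thus ?thesis by (simp add: f.diff f.sum f.scale)
    qed
    have 2: "(\<Sum>b\<in>B. pm_scale (c (u i) b) (f b - (\<Sum>j\<in>I. pm_scale (coord (f b) j) (u j)))) \<in> W"
      by (intro pm.subspace_sum[OF W] pm.subspace_scale[OF W] co fV BV)
    have 3: "f (u i) - (\<Sum>j\<in>I. pm_scale (coord (f (u i)) j) (u j)) \<in> W"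
      by (intro co fV uV i)
    have "(\<Sum>j\<in>I. pm_scale (coord (f (u i)) j - (\<Sum>b\<in>B. c (u i) b * coord (f b) j)) (u j))
       = (f (u i) - (\<Sum>b\<in>B. pm_scale (c (u i) b) (f b)))
         + (\<Sum>b\<in>B. pm_scale (c (u i) b) (f b - (\<Sum>j\<in>I. pm_scale (coord (f b) j) (u j))))
         - (f (u i) - (\<Sum>j\<in>I. pm_scale (coord (f (u i)) j) (u j)))"
      by (simp add: pm.scale_right_diff_distrib pm.scale_left_diff_distrib sum_subtractf
          pm.scale_sum_left pm.scale_sum_right sum.swap[of _ I B])
    also have "\<dots> \<in> W"
      by (intro pm.subspace_add[OF W] pm.subspace_diff[OF W] 1 2 3)
    finally show ?thesis using ind[of "\<lambda>j. coord (f (u i)) j - (\<Sum>b\<in>B. c (u i) b * coord (f b) j)"] i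
      by simp
  qed
  have "(\<Sum>b\<in>B. c (f b) b) = (\<Sum>b\<in>B. \<Sum>i\<in>I. coord (f b) i * c (u i) b)"
    by (intro sum.cong refl fun_cong[OF c_eq]) (use BV f(2) in blast)
  also have "\<dots> = (\<Sum>i\<in>I. coord (f (u i)) i)"
    by (subst sum.swap) (simp add: chi mult.commute)
  finally show ?thesis unfolding c_def .
qed

lemma quot_trace_eq:
  assumes "quot_family V W I u coord" "pm.subspace W"
    and "pm_linear f" "f ` V \<subseteq> V" "f ` W \<subseteq> W"
  shows "quot_trace V W f = (\<Sum>i\<in>I. coord (f (u i)) i)"
proof -
  have ex: "\<exists>B. quot_basis V W B" using quot_family_quot_basis[OF assms(1,2)] by blast
  show ?thesis
    unfolding quot_trace_def Let_def
    using quot_basis_trace_eq[OF assms(1,2) someI_ex[OF ex] assms(3-5)] ex by simp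
qed

text \<open>In characteristic \<open>0\<close> the size of a basis is the trace of the identity, so invariance of
  dimension is a case of invariance of the trace.\<close>

lemma quot_dim_eq:
  fixes V W :: "('k \<Rightarrow>\<^sub>0 'a::field_char_0) set"
  assumes fam: "quot_family V W I u coord" and W: "pm.subspace W"
  shows "quot_dim V W = card I"
proof -
  have ex: "\<exists>B. quot_basis V W B" using quot_family_quot_basis[OF assms] by blast
  define B where "B = (SOME B. quot_basis V W B)"
  have B: "quot_basis V W B" unfolding B_def by (rule someI_ex[OF ex])
  have coord1: "(THE c. quot_coords W B b c) b = 1" if b: "b \<in> B" for b
  proof -
    have fin: "finite B" and ex1: "\<exists>!c. quot_coords W B b c"
      using B b unfolding quot_basis_def by auto
    have "(\<Sum>b'\<in>B. pm_scale (if b' = b then 1 else 0) b') = (\<Sum>b'\<in>B. if b' = b then b' else 0)"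
      by (intro sum.cong) auto
    also have "\<dots> = b" using fin b by simp
    finally have "quot_coords W B b (\<lambda>b'. if b' = b then 1 else 0)"
      unfolding quot_coords_def using b pm.subspace_0[OF W] by auto
    from the1_equality[where P = "quot_coords W B b", OF ex1 this] show ?thesis by simp
  qed
  have delta: "coord (u i) i = 1" if i: "i \<in> I" for i
  proof -
    have fin: "finite I" and uV: "u i \<in> V"
      and co: "\<And>v. v \<in> V \<Longrightarrow> v - (\<Sum>i\<in>I. pm_scale (coord v i) (u i)) \<in> W"
      and ind: "\<And>d. (\<Sum>i\<in>I. pm_scale (d i) (u i)) \<in> W \<Longrightarrow> \<forall>i\<in>I. d i = 0"
      using fam i unfolding quot_family_def by auto
    have "(\<Sum>j\<in>I. pm_scale (if j = i then 1 else 0) (u j)) = (\<Sum>j\<in>I. if j = i then u j else 0)"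
      by (intro sum.cong) auto
    also have "\<dots> = u i" using fin i by simp
    finally have "u i - (\<Sum>j\<in>I. pm_scale (coord (u i) j) (u j))
      = (\<Sum>j\<in>I. pm_scale ((if j = i then 1 else 0) - coord (u i) j) (u j))"
      by (simp add: pm.scale_left_diff_distrib sum_subtractf)
    hence "(\<Sum>j\<in>I. pm_scale ((if j = i then 1 else 0) - coord (u i) j) (u j)) \<in> W"
      using co[OF uV] by simp
    from ind[OF this] i show ?thesis by auto
  qed
  have "pm_linear (\<lambda>x::'k \<Rightarrow>\<^sub>0 'a. x)" by (rule pm_linearI) auto
  from quot_basis_trace_eq[OF fam W B this]
  have "of_nat (card B) = (of_nat (card I) :: 'a)" by (simp add: coord1 delta)
  thus ?thesis unfolding quot_dim_def using ex by (simp add: B_def)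
qed

text \<open>T induces an isomorphism from V / W onto U, so a basis of U lifts through arbitrary
  preimages, and the coordinates of v are those of \<open>T v\<close>.\<close>

lemma quot_family_pullback:
  assumes V: "pm.subspace V" and T: "pm_linear T" "T ` V = U"
    and ker: "\<And>v. v \<in> V \<Longrightarrow> T v = 0 \<longleftrightarrow> v \<in> W" "W \<subseteq> V"
    and fam: "quot_family U {0} I u coord"
  obtains u' where "\<And>i. i \<in> I \<Longrightarrow> u' i \<in> V" "\<And>i. i \<in> I \<Longrightarrow> T (u' i) = u i"
    "quot_family V W I u' (\<lambda>v. coord (T v))"
proof -
  interpret T: Vector_Spaces.linear pm_scale pm_scale T by (fact T(1))
  have fin: "finite I" and uU: "\<And>i. i \<in> I \<Longrightarrow> u i \<in> U"
    and co: "\<And>v. v \<in> U \<Longrightarrow> v - (\<Sum>i\<in>I. pm_scale (coord v i) (u i)) = 0"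
    and ind: "\<And>d. (\<Sum>i\<in>I. pm_scale (d i) (u i)) = 0 \<Longrightarrow> \<forall>i\<in>I. d i = 0"
    using fam unfolding quot_family_def by blast+
  define u' where "u' i = inv_into V T (u i)" for i
  have u': "u' i \<in> V" "T (u' i) = u i" if "i \<in> I" for i
    using uU[OF that] by (simp_all add: u'_def inv_into_into f_inv_into_f flip: T(2))
  have Tsum: "T (\<Sum>i\<in>I. pm_scale (d i) (u' i)) = (\<Sum>i\<in>I. pm_scale (d i) (u i))" for d
    by (simp add: T.sum T.scale u')
  have "quot_family V W I u' (\<lambda>v. coord (T v))"
    unfolding quot_family_def
  proof (intro conjI allI impI)
    show "\<forall>v\<in>V. v - (\<Sum>i\<in>I. pm_scale (coord (T v) i) (u' i)) \<in> W"
    proof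
      fix v assume v: "v \<in> V"
      have "v - (\<Sum>i\<in>I. pm_scale (coord (T v) i) (u' i)) \<in> V"
        by (intro pm.subspace_diff[OF V] v pm.subspace_sum[OF V] pm.subspace_scale[OF V] u')
      moreover have "T (v - (\<Sum>i\<in>I. pm_scale (coord (T v) i) (u' i))) = 0"
        unfolding T.diff Tsum by (intro co) (simp add: v flip: T(2))
      ultimately show "v - (\<Sum>i\<in>I. pm_scale (coord (T v) i) (u' i)) \<in> W" by (simp add: ker(1))
    qed
  next
    fix d assume "(\<Sum>i\<in>I. pm_scale (d i) (u' i)) \<in> W"
    hence "T (\<Sum>i\<in>I. pm_scale (d i) (u' i)) = 0" using ker by blast
    thus "\<forall>i\<in>I. d i = 0" unfolding Tsum by (rule ind)
  qed (use fin u' in auto)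
  with u' show ?thesis by (rule that)
qed

lemma subspace_pullback_kernel:
  assumes V: "pm.subspace V" and T: "pm_linear T"
    and ker: "\<And>v. v \<in> V \<Longrightarrow> T v = 0 \<longleftrightarrow> v \<in> W" "W \<subseteq> V"
  shows "pm.subspace W"
proof -
  interpret T: Vector_Spaces.linear pm_scale pm_scale T by (fact T)
  have "W = V \<inter> {v. T v = 0}" using ker by auto
  thus ?thesis using pm.subspace_inter[OF V T.subspace_kernel] by simp
qed

text \<open>Since T intertwines \<open>f\<close> with \<open>g\<close>, the trace on V / W can be
  read off in the concrete space U. It is applied twice with U the space \<open>zero_sum n\<close>:
  to the proper polynomials and to the Specht module.\<close>

lemma quot_trace_pullback:
  assumes V: "pm.subspace V" and T: "pm_linear T" "T ` V = U"
    and ker: "\<And>v. v \<in> V \<Longrightarrow> T v = 0 \<longleftrightarrow> v \<in> W" "W \<subseteq> V"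
    and fam: "quot_family U {0} I u coord"
    and f: "pm_linear f" "f ` V \<subseteq> V" "\<And>v. v \<in> V \<Longrightarrow> T (f v) = g (T v)" and g: "g 0 = 0"
  shows "quot_trace V W f = (\<Sum>i\<in>I. coord (g (u i)) i)"
proof -
  obtain u' where u': "\<And>i. i \<in> I \<Longrightarrow> u' i \<in> V" "\<And>i. i \<in> I \<Longrightarrow> T (u' i) = u i"
    "quot_family V W I u' (\<lambda>v. coord (T v))"
    using quot_family_pullback[OF assms(1-6)] by blast
  \<comment> \<open>W is the kernel of T on V, and T sends \<open>f w\<close> to
    \<open>g 0 = 0\<close>.\<close>
  have "f ` W \<subseteq> W"
  proof
    fix y assume "y \<in> f ` W"
    then obtain w where w: "w \<in> W" "y = f w" by blast
    have wV: "w \<in> V" using ker w by blast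
    have "T y = 0" using f(3)[OF wV] ker w wV g by metis
    moreover have "y \<in> V" using wV f(2) w by blast
    ultimately show "y \<in> W" using ker by blast
  qed
  from quot_trace_eq[OF u'(3) subspace_pullback_kernel[OF V T(1) ker] f(1,2) this]
  show ?thesis using u' f(3) by simp
qed

lemma quot_dim_pullback:
  fixes V :: "('k \<Rightarrow>\<^sub>0 'a::field_char_0) set"
  assumes V: "pm.subspace V" and T: "pm_linear T" "T ` V = U"
    and ker: "\<And>v. v \<in> V \<Longrightarrow> T v = 0 \<longleftrightarrow> v \<in> W" "W \<subseteq> V"
    and fam: "quot_family U {0} I u coord"
  shows "quot_dim V W = card I"
  using quot_family_pullback[OF assms] quot_dim_eq subspace_pullback_kernel[OF V T(1) ker] by metis

section \<open>Linear maps on finitely supported functions\<close>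

lemma pm_push_single: "pm_push h (Poly_Mapping.single k c) = Poly_Mapping.single (h k) c"
  by (cases "c = 0") (simp_all add: pm_push_def)

lemma pm_push_superset:
  assumes "finite K" "Poly_Mapping.keys p \<subseteq> K"
  shows "pm_push h p = (\<Sum>k\<in>K. Poly_Mapping.single (h k) (Poly_Mapping.lookup p k))"
  unfolding pm_push_def using assms
  by (intro sum.mono_neutral_left) (auto simp: in_keys_iff)

lemma keys_pm_scale: "Poly_Mapping.keys (pm_scale c p) \<subseteq> Poly_Mapping.keys p"
  by (auto simp: in_keys_iff lookup_pm_scale)

lemma pm_scale_single: "pm_scale c (Poly_Mapping.single k d) = Poly_Mapping.single k (c * d)"
  by (rule poly_mapping_eqI) (simp add: lookup_pm_scale lookup_single when_def)

lemma pm_push_linear: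
  fixes h :: "'k \<Rightarrow> 'l"
  shows "pm_linear (pm_push h :: ('k \<Rightarrow>\<^sub>0 'a::field) \<Rightarrow> _)"
proof (rule pm_linearI)
  fix p q :: "'k \<Rightarrow>\<^sub>0 'a"
  let ?K = "Poly_Mapping.keys p \<union> Poly_Mapping.keys q"
  have fin: "finite ?K" by simp
  show "pm_push h (p + q) = pm_push h p + pm_push h q"
    unfolding pm_push_superset[OF fin Poly_Mapping.keys_add] pm_push_superset[OF fin Un_upper1]
      pm_push_superset[OF fin Un_upper2]
    by (simp add: lookup_add single_add sum.distrib)
next
  fix c and p :: "'k \<Rightarrow>\<^sub>0 'a"
  show "pm_push h (pm_scale c p) = pm_scale c (pm_push h p)"
    unfolding pm_push_superset[OF finite_keys keys_pm_scale]
      pm_push_superset[of _ p, OF finite_keys subset_refl]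
    by (simp add: lookup_pm_scale pm.scale_sum_right pm_scale_single)
qed

lemma pm_push_id: "pm_push (\<lambda>k. k) p = p"
proof (rule poly_mapping_eqI)
  fix k
  show "Poly_Mapping.lookup (pm_push (\<lambda>k. k) p) k = Poly_Mapping.lookup p k"
    by (auto simp: pm_push_def lookup_sum lookup_single when_def in_keys_iff)
qed

lemma pm_span_singles:
  "pm.span (range (\<lambda>k::'k. Poly_Mapping.single k (1::'a::field))) = UNIV"
proof (intro equalityI subset_UNIV subsetI)
  fix p :: "'k \<Rightarrow>\<^sub>0 'a"
  have "(\<Sum>k\<in>Poly_Mapping.keys p. pm_scale (Poly_Mapping.lookup p k) (Poly_Mapping.single k 1)) = p"
    using pm_push_id[of p] by (simp add: pm_push_def pm_scale_single)
  moreover have "(\<Sum>k\<in>Poly_Mapping.keys p. pm_scale (Poly_Mapping.lookup p k) (Poly_Mapping.single k 1))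
      \<in> pm.span (range (\<lambda>k. Poly_Mapping.single k (1::'a)))"
    by (intro pm.span_sum pm.span_scale pm.span_base) auto
  ultimately show "p \<in> pm.span (range (\<lambda>k. Poly_Mapping.single k (1::'a)))" by simp
qed

lemma pm_induct [case_names zero step]:
  fixes p :: "'k \<Rightarrow>\<^sub>0 'a::field"
  assumes "P 0" "\<And>c k p. P p \<Longrightarrow> P (pm_scale c (Poly_Mapping.single k 1) + p)"
  shows "P p"
proof -
  have "p \<in> pm.span (range (\<lambda>k. Poly_Mapping.single k (1::'a)))" by (simp add: pm_span_singles)
  thus ?thesis by (induction rule: pm.span_induct_alt) (use assms in auto)
qed

lemma pm_scale_mult_left:
  fixes p q :: "'k::monoid_add \<Rightarrow>\<^sub>0 'a::field"
  shows "pm_scale c p * q = pm_scale c (p * q)"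
proof -
  \<comment> \<open>Scaling is left multiplication by a constant polynomial, which turns the claim
    into associativity.\<close>
  have sc: "pm_scale c p = Poly_Mapping.single 0 c * p" for p :: "'k \<Rightarrow>\<^sub>0 'a"
    by (induction p rule: pm_induct)
      (simp_all add: pm.scale_right_distrib distrib_left pm_scale_single mult_single)
  show ?thesis by (simp only: sc mult.assoc)
qed

lemma pm_scale_mult_right:
  fixes p q :: "'k::monoid_add \<Rightarrow>\<^sub>0 'a::field"
  shows "p * pm_scale c q = pm_scale c (p * q)"
proof (induction p rule: pm_induct)
  case (step d k p)
  have "Poly_Mapping.single k 1 * pm_scale c q = pm_scale c (Poly_Mapping.single k 1 * q)"
    by (induction q rule: pm_induct)
      (simp_all add: pm.scale_right_distrib distrib_left pm_scale_single mult_single)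
  with step show ?case
    by (simp add: distrib_right pm.scale_right_distrib pm_scale_mult_left mult.commute)
qed simp

text \<open>Bilinear extension: reduces multiplicativity of evaluation and of pushforward to pairs
  of basis elements.\<close>

lemma pm_mult_induct [case_names zero1 zero2 add1 add2 scale1 scale2 single]:
  fixes p q :: "'k \<Rightarrow>\<^sub>0 'a::field"
  assumes "\<And>q. P 0 q" "\<And>p. P p 0"
    and "\<And>p p' q. P p q \<Longrightarrow> P p' q \<Longrightarrow> P (p + p') q" "\<And>p q q'. P p q \<Longrightarrow> P p q' \<Longrightarrow> P p (q + q')"
    and "\<And>c p q. P p q \<Longrightarrow> P (pm_scale c p) q" "\<And>c p q. P p q \<Longrightarrow> P p (pm_scale c q)"
    and "\<And>k l. P (Poly_Mapping.single k 1) (Poly_Mapping.single l 1)"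
  shows "P p q"
proof (induction p rule: pm_induct)
  case zero
  show ?case by (fact assms(1))
next
  case (step c k p)
  have "P (Poly_Mapping.single k 1) q"
  proof (induction q rule: pm_induct)
    case zero
    show ?case by (fact assms(2))
  next
    case (step d l q)
    show ?case by (rule assms(4)[OF assms(6)[OF assms(7)] step])
  qed
  from assms(3)[OF assms(5)[OF this] step] show ?case .
qed

lemma pm_push_mult:
  assumes "\<And>u v. h (u + v) = h u + h v"
  shows "pm_push h (p * q) = pm_push h p * pm_push h q"
proof -
  interpret h: Vector_Spaces.linear pm_scale pm_scale "pm_push h" by (rule pm_push_linear)
  show ?thesis
    by (induction p q rule: pm_mult_induct)
      (simp_all add: h.add h.scale distrib_left distrib_right pm_scale_mult_left pm_scale_mult_right
        mult_single pm_push_single assms)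
qed

section \<open>Evaluation of polynomials\<close>

lemma matrix_add_rdistrib: "(A + B) ** C = A ** C + B ** (C :: 'a::semiring_1^'n^'m)"
  by (vector matrix_matrix_mult_def sum.distrib distrib_right)

definition word_val :: "('v \<Rightarrow> 'a::field^'d^'d) \<Rightarrow> 'v word \<Rightarrow> 'a^'d^'d" where
  "word_val s w = foldr (\<lambda>x M. s x ** M) (letters w) (mat 1)"

lemma mat_mult_component: "(mat c ** M) $ i $ j = c * (M :: 'a::field^'d^'d) $ i $ j"
proof -
  have "(mat c ** M) $ i $ j = (\<Sum>k\<in>UNIV. if k = i then c * M $ k $ j else 0)"
    by (simp add: matrix_matrix_mult_def mat_def if_distrib[of "\<lambda>x. x * _"] eq_commute[of i]
        cong: if_cong)
  thus ?thesis by simp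
qed

lemma eval_free_superset:
  assumes "finite K" "Poly_Mapping.keys p \<subseteq> K"
  shows "eval_free s p = (\<Sum>w\<in>K. mat (Poly_Mapping.lookup p w) ** word_val s w)"
  unfolding eval_free_def word_val_def using assms
  by (intro sum.mono_neutral_left) (auto simp: in_keys_iff mat_mult_component vec_eq_iff)

lemma eval_free_single: "eval_free s (Poly_Mapping.single w c) = mat c ** word_val s w"
  by (subst eval_free_superset[of "{w}"]) auto

lemma eval_free_zero: "eval_free s 0 = 0"
  by (simp add: eval_free_def)

lemma eval_free_add: "eval_free s (p + q) = eval_free s p + eval_free s q"
proof -
  let ?K = "Poly_Mapping.keys p \<union> Poly_Mapping.keys q"
  have fin: "finite ?K" by simp
  show ?thesis
    unfolding eval_free_superset[OF fin Poly_Mapping.keys_add] eval_free_superset[OF fin Un_upper1]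
      eval_free_superset[OF fin Un_upper2]
    by (simp add: vec_eq_iff mat_mult_component lookup_add distrib_right sum.distrib)
qed

lemma eval_free_scale: "eval_free s (pm_scale c p) = mat c ** eval_free s p"
proof -
  have fin: "finite (Poly_Mapping.keys p)" by simp
  show ?thesis
    unfolding eval_free_superset[OF fin keys_pm_scale] eval_free_superset[OF fin subset_refl]
    by (simp add: vec_eq_iff mat_mult_component lookup_pm_scale sum_distrib_left mult.assoc)
qed

lemma eval_free_diff: "eval_free s (p - q) = eval_free s p - eval_free s q"
  using eval_free_add[of s "p - q" q] by simp

lemma mat_mult_commute: "M ** mat c = mat c ** (M :: 'a::field^'d^'d)"
proof -
  have "(M ** mat c) $ i $ j = (\<Sum>k\<in>UNIV. if k = j then M $ i $ k * c else 0)" for i j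
    by (simp add: matrix_matrix_mult_def mat_def if_distrib[of "\<lambda>x. _ * x"] cong: if_cong)
  thus ?thesis by (simp add: vec_eq_iff mat_mult_component mult.commute)
qed

lemma word_val_zero: "word_val s 0 = mat 1"
  by (simp add: word_val_def zero_word_def)

lemma word_val_add: "word_val s (u + v) = word_val s u ** word_val s v"
proof -
  \<comment> \<open>Folding a concatenation starts the outer fold at the value of the second word
    instead of \<open>mat 1\<close>.\<close>
  have "foldr (\<lambda>x M. s x ** M) xs N = foldr (\<lambda>x M. s x ** M) xs (mat 1) ** N" for xs N
    by (induction xs) (auto simp: matrix_mul_assoc)
  thus ?thesis by (simp add: word_val_def plus_word_def)
qed

lemma mat_pull_left: "(mat c ** M) ** N = mat c ** (M ** N)"
  by (simp add: matrix_mul_assoc)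

lemma mat_pull_right: "M ** (mat c ** N) = mat c ** (M ** N)"
  for M N :: "'a::field^'d^'d"
  by (simp add: matrix_mul_assoc mat_mult_commute[of M])

lemma eval_free_mult: "eval_free s (p * q) = eval_free s p ** eval_free s q"
  by (induction p q rule: pm_mult_induct)
    (simp_all add: eval_free_zero eval_free_add eval_free_scale distrib_left distrib_right
      pm_scale_mult_left pm_scale_mult_right mult_single eval_free_single word_val_add
      matrix_add_ldistrib matrix_add_rdistrib mat_pull_left mat_pull_right)

lemma eval_free_one: "eval_free s 1 = mat 1"
  by (simp add: eval_free_single word_val_zero flip: single_one)

lemma eval_free_Var: "eval_free s (Var x) = s x"
  by (simp add: Var_def eval_free_single word_val_def)

section \<open>Commutators and scalar shifts of the substituted matrices\<close>

definition mat_commutator :: "'a::field^'d^'d \<Rightarrow> 'a^'d^'d \<Rightarrow> 'a^'d^'d" where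
  "mat_commutator A B = A ** B - B ** A"

lemma eval_free_commutator:
  "eval_free s (commutator p q) = mat_commutator (eval_free s p) (eval_free s q)"
  by (simp add: commutator_def mat_commutator_def eval_free_diff eval_free_mult)

lemma eval_free_foldl_commutator:
  "eval_free s (foldl (\<lambda>p y. commutator p (Var y)) p ys)
   = foldl (\<lambda>A y. mat_commutator A (s y)) (eval_free s p) ys"
  by (induction ys arbitrary: p) (simp_all add: eval_free_commutator eval_free_Var)

lemma mat_commutator_add_scalar:
  "mat_commutator (A + mat a) (B + mat b) = mat_commutator A B"
  by (simp add: mat_commutator_def matrix_add_ldistrib matrix_add_rdistrib
      mat_mult_commute[of A] mat_mult_commute[of B] mat_mult_commute[of "mat a" b])

text \<open>Scalar matrices are central, so commutators of variables do not see the shift; the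
  remaining generators, variables of nonzero degree, are not shifted. Both substitutions thus agree
  on generators, hence on the subalgebra.\<close>

lemma eval_free_Y_proper_shift:
  assumes p: "p \<in> Y_proper"
    and s0: "\<And>i. \<exists>c. s (i, 0) = s' (i, 0) + mat c"
    and s1: "\<And>i g. g \<noteq> 0 \<Longrightarrow> s (i, g) = s' (i, g)"
  shows "eval_free s p = eval_free s' p"
proof -
  have shift: "\<exists>c. s x = s' x + mat c" for x
    using s0 s1 by (cases x; cases "snd x = 0") (auto intro: exI[of _ 0])
  have step: "mat_commutator (A + mat a) (s y) = mat_commutator A (s' y)" for A a y
    using shift[of y] mat_commutator_add_scalar by metis
  have step0: "mat_commutator A (s y) = mat_commutator A (s' y)" for A y
    using step[of A 0 y] by simp
  show ?thesis
    using p unfolding Y_proper_def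
  proof (induction rule: unitary_subalgebra.induct)
    case (gen p)
    show ?case
    proof (cases "p \<in> commutators")
      case True
      then obtain x y ys where p: "p = foldl (\<lambda>p y. commutator p (Var y)) (Var x) (y # ys)"
        unfolding commutators_def by (auto simp: neq_Nil_conv)
      \<comment> \<open>Only the innermost commutator has a shifted left entry; further out the left
        entries already agree, and \<open>step0\<close> handles the right ones.\<close>
      obtain a where "s x = s' x + mat a" using shift by blast
      thus ?thesis
        by (simp add: p eval_free_foldl_commutator eval_free_commutator eval_free_Var step0
              mat_commutator_add_scalar[of _ _ _ 0, simplified])
    qed (use gen in \<open>auto simp: eval_free_Var s1\<close>)
  qed (simp_all add: eval_free_add eval_free_mult eval_free_scale eval_free_one)
qed

lemma eval_free_perm_act:
  fixes p :: "('g, 'a::field) free_alg"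
  shows "eval_free s (perm_act \<sigma> p) = eval_free (\<lambda>(i, g). s (\<sigma> i, g)) p"
proof -
  interpret h: Vector_Spaces.linear pm_scale pm_scale "perm_act \<sigma> :: ('g, 'a) free_alg \<Rightarrow> ('g, 'a) free_alg"
    unfolding perm_act_def by (rule pm_push_linear)
  have "word_val s (Word (map (\<lambda>(i, g). (\<sigma> i, g)) l)) = word_val (\<lambda>(i, g). s (\<sigma> i, g)) (Word l)" for l
    by (induction l) (auto simp: word_val_def)
  hence "eval_free s (perm_act \<sigma> (Poly_Mapping.single w 1))
      = eval_free (\<lambda>(i, g). s (\<sigma> i, g)) (Poly_Mapping.single w 1 :: ('g, 'a) free_alg)" for w
    by (cases w) (simp add: perm_act_def pm_push_single eval_free_single)
  thus ?thesis
    by (induction p rule: pm_induct)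
      (simp_all add: h.add h.scale h.zero eval_free_zero eval_free_add eval_free_scale)
qed

lemma lookup_pm_push_bij:
  assumes "bij h"
  shows "Poly_Mapping.lookup (pm_push h p) (h k) = Poly_Mapping.lookup p k"
  using assms
  by (auto simp: pm_push_def lookup_sum lookup_single when_def in_keys_iff bij_def inj_eq)

section \<open>Vectors of coordinate sum zero\<close>

definition zero_sum :: "nat \<Rightarrow> (nat \<Rightarrow>\<^sub>0 'a::field) set" where
  "zero_sum n = {x. Poly_Mapping.keys x \<subseteq> {..<n} \<and> (\<Sum>i<n. Poly_Mapping.lookup x i) = 0}"

definition basis_diff :: "nat \<Rightarrow> (nat \<Rightarrow>\<^sub>0 'a::field)" where
  "basis_diff i = Poly_Mapping.single i 1 - Poly_Mapping.single 0 1"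

lemma subspace_zero_sum: "pm.subspace (zero_sum n)"
  unfolding pm.subspace_def zero_sum_def
  using Poly_Mapping.keys_add keys_pm_scale
  by (fastforce simp: lookup_add lookup_pm_scale sum.distrib simp flip: sum_distrib_left)

lemma single_diff_zero_sum:
  assumes "i < n" "j < n"
  shows "Poly_Mapping.single i 1 - Poly_Mapping.single j (1::'a::field) \<in> zero_sum n"
  using assms
  by (auto simp: zero_sum_def in_keys_iff lookup_minus lookup_single when_def sum_subtractf
      split: if_splits)

lemma lookup_basis_diff:
  "i \<noteq> 0 \<Longrightarrow> Poly_Mapping.lookup (basis_diff j :: nat \<Rightarrow>\<^sub>0 'a::field) i = (if i = j then 1 else 0)"
  by (auto simp: basis_diff_def lookup_minus lookup_single when_def simp del: single_one)

text \<open>At a positive index only the \<open>basis_diff\<close> with that index is nonzero, so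
  the entries of x there are its coordinates. The entry at 0 is then forced by the vanishing
  sum.\<close>

lemma zero_sum_expand:
  assumes "x \<in> zero_sum n"
  shows "x = (\<Sum>i\<in>{1..<n}. pm_scale (Poly_Mapping.lookup x i) (basis_diff i))"
proof (rule poly_mapping_eqI)
  fix k
  let ?y = "\<Sum>i\<in>{1..<n}. pm_scale (Poly_Mapping.lookup x i) (basis_diff i)"
  have nz: "Poly_Mapping.lookup ?y k = Poly_Mapping.lookup x k" if k: "k \<noteq> 0"
  proof -
    have "Poly_Mapping.lookup ?y k = (\<Sum>i\<in>{1..<n}. if i = k then Poly_Mapping.lookup x i else 0)"
      by (intro trans[OF lookup_sum] sum.cong) (auto simp: lookup_pm_scale lookup_basis_diff[OF k])
    also have "\<dots> = Poly_Mapping.lookup x k"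
      using assms k by (auto simp: zero_sum_def in_keys_iff subset_iff)
    finally show ?thesis .
  qed
  show "Poly_Mapping.lookup x k = Poly_Mapping.lookup ?y k"
  proof (cases "k = 0")
    case True
    have "Poly_Mapping.lookup x 0 = - (\<Sum>i\<in>{1..<n}. Poly_Mapping.lookup x i)"
    proof (cases "n = 0")
      case False
      hence "{..<n} = insert 0 {1..<n}" by auto
      hence "(\<Sum>i<n. Poly_Mapping.lookup x i)
          = Poly_Mapping.lookup x 0 + (\<Sum>i\<in>{1..<n}. Poly_Mapping.lookup x i)"
        by simp
      thus ?thesis using assms by (simp add: zero_sum_def eq_neg_iff_add_eq_0)
    qed (use assms in \<open>simp add: zero_sum_def\<close>)
    thus ?thesis
      by (simp add: True lookup_sum lookup_pm_scale basis_diff_def lookup_minus lookup_single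
          when_def sum_negf del: single_one)
  qed (rule nz[symmetric])
qed

lemma zero_sum_subset:
  assumes "pm.subspace S" "\<And>i. 1 \<le> i \<Longrightarrow> i < n \<Longrightarrow> basis_diff i \<in> S"
  shows "zero_sum n \<subseteq> S"
proof
  fix x :: "nat \<Rightarrow>\<^sub>0 'a" assume "x \<in> zero_sum n"
  hence "x = (\<Sum>i\<in>{1..<n}. pm_scale (Poly_Mapping.lookup x i) (basis_diff i))"
    by (rule zero_sum_expand)
  also have "\<dots> \<in> S"
    by (intro pm.subspace_sum pm.subspace_scale assms) auto
  finally show "x \<in> S" .
qed

lemma zero_sum_family:
  "quot_family (zero_sum n) {0} {1..<n} basis_diff Poly_Mapping.lookup"
  unfolding quot_family_def
proof (intro conjI ballI allI impI)
  show "basis_diff ` {1..<n} \<subseteq> zero_sum n"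
    using single_diff_zero_sum[of _ n 0] by (auto simp: basis_diff_def)
next
  fix v :: "nat \<Rightarrow>\<^sub>0 'a" assume "v \<in> zero_sum n"
  from zero_sum_expand[OF this]
  show "v - (\<Sum>i\<in>{1..<n}. pm_scale (Poly_Mapping.lookup v i) (basis_diff i)) \<in> {0}" by simp
next
  fix d :: "nat \<Rightarrow> 'a" and k
  assume *: "(\<Sum>i\<in>{1..<n}. pm_scale (d i) (basis_diff i)) \<in> {0}" and k: "k \<in> {1..<n}"
  have "0 = Poly_Mapping.lookup (\<Sum>i\<in>{1..<n}. pm_scale (d i) (basis_diff i)) k"
    using * by simp
  also have "\<dots> = (\<Sum>i\<in>{1..<n}. if i = k then d i else 0)"
    using k by (intro trans[OF lookup_sum] sum.cong) (auto simp: lookup_pm_scale lookup_basis_diff)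
  also have "\<dots> = d k" using k by simp
  finally show "d k = 0" by simp
qed auto

lemma pm_push_zero_sum:
  assumes \<sigma>: "\<sigma> permutes {..<n}" and x: "x \<in> zero_sum n"
  shows "pm_push \<sigma> x \<in> zero_sum n"
proof -
  have bij: "bij \<sigma>" using \<sigma> by (rule permutes_bij)
  have "Poly_Mapping.lookup (pm_push \<sigma> x) k = 0" if "\<not> k < n" for k
  proof -
    have "\<sigma> k = k" using \<sigma> that by (simp add: permutes_def)
    thus ?thesis
      using lookup_pm_push_bij[OF bij, of x k] x that by (auto simp: zero_sum_def in_keys_iff)
  qed
  moreover have "(\<Sum>i<n. Poly_Mapping.lookup (pm_push \<sigma> x) i)
      = (\<Sum>i<n. Poly_Mapping.lookup (pm_push \<sigma> x) (\<sigma> i))"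
    using sum.permute[OF \<sigma>] by (simp add: o_def)
  ultimately show ?thesis
    using x by (auto simp: zero_sum_def in_keys_iff lookup_pm_push_bij[OF bij])
qed

section \<open>The proper multilinear polynomials modulo identities\<close>

text \<open>The normal form of an upper triangular matrix after subtracting its (2,2) entry as a
  scalar. Products are simple: (a, b) times (c, d) is (ac, ad).\<close>

definition row_mat :: "'a::field \<Rightarrow> 'a \<Rightarrow> 'a^2^2" where
  "row_mat a b = (\<chi> i j. if i = 1 then (if j = 1 then a else b) else 0)"

lemma row_mat_component [simp]:
  "row_mat a b $ 1 $ 1 = a" "row_mat a b $ 1 $ 2 = b" "row_mat a b $ 2 $ j = 0"
  by (simp_all add: row_mat_def)

lemma row_mat_mult:
  "(row_mat a b ** M) $ 1 $ j = a * M $ 1 $ j + b * M $ 2 $ j" "(row_mat a b ** M) $ 2 $ j = 0"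
  by (simp_all add: matrix_matrix_mult_def sum_2)

text \<open>Variables of degree 1 go to 0, the only element of that component for the constant pair
  (0,0).\<close>

definition row_subst :: "(nat \<Rightarrow> 'a::field) \<Rightarrow> (nat \<Rightarrow> 'a) \<Rightarrow> nat \<times> bit \<Rightarrow> 'a^2^2" where
  "row_subst a b = (\<lambda>(i, g). if g = 0 then row_mat (a i) (b i) else 0)"

lemma word_val_vanishing:
  assumes "s x = 0" "x \<in> set xs"
  shows "word_val s (Word xs) = 0"
  using assms(2)
  by (induction xs) (auto simp: word_val_def assms(1) matrix_matrix_mult_def vec_eq_iff)

text \<open>The off-diagonal entry of every factor but the last meets a zero second row, so only the
  last letter contributes its \<open>b\<close>.\<close>

lemma word_val_row_subst:
  assumes "\<And>k. k \<in> set xs \<Longrightarrow> g k = 0" "g l = 0"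
  shows "word_val (row_subst a b) (Word (map (\<lambda>k. (f k, g k)) xs @ [(f l, g l)]))
    = row_mat (prod_list (map (\<lambda>k. a (f k)) xs) * a (f l)) (prod_list (map (\<lambda>k. a (f k)) xs) * b (f l))"
  using assms
  by (induction xs) (simp_all add: word_val_def row_subst_def vec_eq_iff forall_2 row_mat_mult mult.assoc)

lemma word_val_row_subst_monomial:
  assumes \<sigma>: "\<sigma> permutes {..<n}" and n: "n > 0" and g: "\<And>k. k < n \<Longrightarrow> g k = 0"
  shows "word_val (row_subst a b) (Word (map (\<lambda>k. (\<sigma> k, g k)) [0..<n]))
    = row_mat (\<Prod>i<n. a i) ((\<Prod>i\<in>{..<n} - {\<sigma> (n - 1)}. a i) * b (\<sigma> (n - 1)))"
proof -
  obtain m where m: "n = Suc m" using n by (cases n) auto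
  have \<sigma>m: "\<sigma> m < n" using permutes_in_image[OF \<sigma>, of m] m by simp
  \<comment> \<open>The letters before the last one are exactly the variables other than the last,
    each once.\<close>
  have "\<sigma> ` {..<m} = {..<n} - {\<sigma> m}"
  proof -
    have "{..<m} = {..<n} - {m}" using m by auto
    hence "\<sigma> ` {..<m} = \<sigma> ` {..<n} - \<sigma> ` {m}"
      using image_set_diff[OF permutes_inj[OF \<sigma>]] by metis
    thus ?thesis using permutes_image[OF \<sigma>] by simp
  qed
  moreover have "prod_list (map (\<lambda>k. a (\<sigma> k)) [0..<m]) = (\<Prod>k<m. a (\<sigma> k))"
    using prod.distinct_set_conv_list[of "[0..<m]" "\<lambda>k. a (\<sigma> k)"] by (simp add: atLeast0LessThan)
  moreover have "(\<Prod>k<m. a (\<sigma> k)) = (\<Prod>i\<in>\<sigma> ` {..<m}. a i)"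
    by (simp add: prod.reindex permutes_inj_on[OF \<sigma>])
  ultimately have pl: "prod_list (map (\<lambda>k. a (\<sigma> k)) [0..<m]) = (\<Prod>i\<in>{..<n} - {\<sigma> m}. a i)"
    by simp
  have pr: "(\<Prod>i\<in>{..<n} - {\<sigma> m}. a i) * a (\<sigma> m) = (\<Prod>i<n. a i)"
    using \<sigma>m by (simp add: prod.remove[of "{..<n}" "\<sigma> m"] mult.commute)
  show ?thesis
    using word_val_row_subst[of "[0..<m]" g m a b \<sigma>] g
    by (simp add: m pl pr[unfolded m] del: prod.lessThan_Suc)
qed

text \<open>The vector e(p). With all \<open>a\<close> equal to 1 and \<open>b\<close> the i-th unit
  vector, a monomial in variables of degree 0 has (1,2) entry 1 if it ends with
  \<open>x\<^sub>i\<close>, and 0 otherwise. Encoding by evaluation makes linearity and equivariance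
  properties of \<open>eval_free\<close>.\<close>

definition end_coeffs :: "nat \<Rightarrow> (bit, 'a::field) free_alg \<Rightarrow> (nat \<Rightarrow>\<^sub>0 'a)" where
  "end_coeffs n p = (\<Sum>i<n. Poly_Mapping.single i
     (eval_free (row_subst (\<lambda>_. 1) (\<lambda>j. if j = i then 1 else 0)) p $ 1 $ 2))"

lemma lookup_end_coeffs:
  "Poly_Mapping.lookup (end_coeffs n p) i =
    (if i < n then eval_free (row_subst (\<lambda>_. 1) (\<lambda>j. if j = i then 1 else 0)) p $ 1 $ 2 else 0)"
  by (auto simp: end_coeffs_def lookup_sum lookup_single when_def)

lemma end_coeffs_linear: "pm_linear (end_coeffs n)"
  by (rule pm_linearI; rule poly_mapping_eqI)
    (simp_all add: lookup_end_coeffs lookup_add lookup_pm_scale eval_free_add eval_free_scale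
      mat_mult_component)

lemma multilinear_induct [consumes 1, case_names zero scale_add]:
  assumes "p \<in> multilinear n" "P 0"
    and "\<And>c \<sigma> g q. \<sigma> permutes {..<n} \<Longrightarrow> P q \<Longrightarrow>
      P (pm_scale c (Poly_Mapping.single (Word (map (\<lambda>k. (\<sigma> k, g k)) [0..<n])) 1) + q)"
  shows "P p"
  using assms(1) unfolding multilinear_def
  by (induction rule: pm.span_induct_alt) (use assms(2,3) in auto)

text \<open>Checked monomial by monomial; a letter of degree 1 kills the monomial. The (1,1) entry
  at \<open>a = 1\<close>, \<open>b = 0\<close> is the sum of the coefficients of all monomials in
  variables of degree 0, and sorting these by their last letter gives the last claim.\<close>

lemma eval_row_subst_multilinear:
  assumes p: "p \<in> multilinear n" and n: "n > 0"
  shows "eval_free (row_subst a b) p $ 1 $ 1 =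
       (\<Prod>i<n. a i) * eval_free (row_subst (\<lambda>_. 1) (\<lambda>_. 0)) p $ 1 $ 1 \<and>
     eval_free (row_subst a b) p $ 1 $ 2 =
       (\<Sum>i<n. (\<Prod>j\<in>{..<n} - {i}. a j) * b i * Poly_Mapping.lookup (end_coeffs n p) i) \<and>
     eval_free (row_subst a b) p $ 2 $ j = 0 \<and>
     (\<Sum>i<n. Poly_Mapping.lookup (end_coeffs n p) i) =
       eval_free (row_subst (\<lambda>_. 1) (\<lambda>_. 0)) p $ 1 $ 1"
  using p
proof (induction rule: multilinear_induct)
  case zero
  show ?case by (simp add: eval_free_zero lookup_end_coeffs)
next
  case (scale_add c \<sigma> g q)
  let ?w = "Word (map (\<lambda>k. (\<sigma> k, g k)) [0..<n])"
  let ?m = "Poly_Mapping.single ?w 1 :: (bit, 'a) free_alg"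
  have \<sigma>n: "\<sigma> (n - 1) < n" using permutes_in_image[OF scale_add(1), of "n - 1"] n by simp
  show ?case
  proof (cases "\<forall>k<n. g k = 0")
    case True
    note [simp] = word_val_row_subst_monomial[OF scale_add(1) n True[rule_format]]
    \<comment> \<open>A new monomial changes only the coefficient at its last letter
      \<open>\<sigma> (n - 1)\<close>.\<close>
    have ec: "Poly_Mapping.lookup (end_coeffs n (pm_scale c ?m + q)) i
        = (if i = \<sigma> (n - 1) then c else 0) + Poly_Mapping.lookup (end_coeffs n q) i" for i
      using \<sigma>n
      by (auto simp: lookup_end_coeffs eval_free_add eval_free_scale mat_mult_component eval_free_single)
    have "(\<Sum>i<n. (\<Prod>j\<in>{..<n} - {i}. a j) * b i * (if i = \<sigma> (n - 1) then c else 0))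
        = (\<Sum>i<n. if i = \<sigma> (n - 1) then (\<Prod>j\<in>{..<n} - {i}. a j) * b i * c else 0)"
      by (intro sum.cong) auto
    also have "\<dots> = (\<Prod>j\<in>{..<n} - {\<sigma> (n - 1)}. a j) * b (\<sigma> (n - 1)) * c"
      using \<sigma>n by simp
    finally show ?thesis
      using scale_add(2) \<sigma>n
      by (simp add: ec eval_free_add eval_free_scale mat_mult_component eval_free_single
          distrib_left sum.distrib mult_ac)
  next
    case False
    then obtain k where k: "k < n" "g k \<noteq> 0" by blast
    have "word_val (row_subst a b) ?w = 0" for a b :: "nat \<Rightarrow> 'a"
      by (rule word_val_vanishing[of _ "(\<sigma> k, g k)"]) (use k in \<open>auto simp: row_subst_def\<close>)
    thus ?thesis
      using scale_add(2)
      by (simp add: lookup_end_coeffs eval_free_add eval_free_scale mat_mult_component eval_free_single)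
  qed
qed

text \<open>The substituted matrix \<open>e\<^sub>1\<^sub>1\<close> may be shifted by the identity
  to \<open>- e\<^sub>2\<^sub>2\<close>, whose first row is 0. As n > 0, each monomial has a first
  factor, so its (1,1) entry vanishes.\<close>

lemma eval_row_subst_proper:
  assumes p: "p \<in> proper_multilinear n" and n: "n > 0"
  shows "eval_free (row_subst (\<lambda>_. 1) (\<lambda>_. 0)) p $ 1 $ 1 = 0"
proof -
  define s :: "nat \<times> bit \<Rightarrow> 'a^2^2"
    where "s = (\<lambda>(i, g). if g = 0 then (\<chi> i j. if i = 2 \<and> j = 2 then -1 else 0) else 0)"
  have "eval_free (row_subst (\<lambda>_. 1) (\<lambda>_. 0)) p = eval_free s p"
  proof (rule eval_free_Y_proper_shift)
    show "p \<in> Y_proper" using p by (simp add: proper_multilinear_def)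
    show "\<exists>c. row_subst (\<lambda>_. 1) (\<lambda>_. 0) (i, 0) = s (i, 0) + mat c" for i
      by (rule exI[of _ 1]) (simp add: s_def row_subst_def vec_eq_iff forall_2 mat_def)
  qed (simp add: s_def row_subst_def)
  moreover have "eval_free s p $ 1 $ 1 = 0"
  proof -
    have s1: "(s x ** M) $ 1 $ 1 = 0" for x M
      by (cases x) (simp add: s_def matrix_matrix_mult_def)
    have "p \<in> multilinear n" using p by (simp add: proper_multilinear_def)
    thus ?thesis
    proof (induction rule: multilinear_induct)
      case (scale_add c \<sigma> g q)
      have "word_val s (Word (map (\<lambda>k. (\<sigma> k, g k)) [0..<n])) $ 1 $ 1 = 0"
        using n by (simp add: word_val_def upt_conv_Cons s1)
      thus ?case using scale_add
        by (simp add: eval_free_add eval_free_scale mat_mult_component eval_free_single)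
    qed (simp add: eval_free_zero)
  qed
  ultimately show ?thesis by simp
qed

section \<open>The graded identities as the kernel of \<open>end_coeffs\<close>\<close>

lemma mem_UT2_trivial:
  "M \<in> UT2 (vector [0, 0] :: bit^2) g \<longleftrightarrow> (if g = 0 then M $ 2 $ 1 = 0 else M = (0 :: 'a::field^2^2))"
  by (cases g) (auto simp: UT2_def vec_eq_iff forall_2)

lemma end_coeffs_eq_0_iff:
  fixes p :: "(bit, 'a::field) free_alg"
  assumes p: "p \<in> proper_multilinear n" and n: "n > 0"
  shows "end_coeffs n p = 0 \<longleftrightarrow> p \<in> graded_identities (UT2 (vector [0, 0] :: bit^2) :: bit \<Rightarrow> ('a^2^2) set)"
proof
  assume "p \<in> graded_identities (UT2 (vector [0, 0] :: bit^2) :: bit \<Rightarrow> ('a^2^2) set)"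
  \<comment> \<open>Each \<open>row_subst\<close> is itself an admissible graded
    substitution.\<close>
  hence "eval_free (row_subst a b) p = 0" for a b
    by (auto simp: graded_identities_def mem_UT2_trivial row_subst_def)
  thus "end_coeffs n p = 0" by (simp add: end_coeffs_def)
next
  assume 0: "end_coeffs n p = 0"
  have ml: "p \<in> multilinear n" and Y: "p \<in> Y_proper" using p by (auto simp: proper_multilinear_def)
  show "p \<in> graded_identities (UT2 (vector [0, 0] :: bit^2) :: bit \<Rightarrow> ('a^2^2) set)"
    unfolding graded_identities_def
  proof (intro CollectI allI impI)
    fix s :: "nat \<times> bit \<Rightarrow> 'a^2^2"
    assume s: "\<forall>i g. s (i, g) \<in> UT2 (vector [0, 0]) g"
    \<comment> \<open>The scalar subtracted from each matrix is its (2,2) entry, which clears the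
      second row.\<close>
    let ?s' = "row_subst (\<lambda>i. s (i, 0) $ 1 $ 1 - s (i, 0) $ 2 $ 2) (\<lambda>i. s (i, 0) $ 1 $ 2)"
    have "eval_free s p = eval_free ?s' p"
    proof (rule eval_free_Y_proper_shift[OF Y])
      show "\<exists>c. s (i, 0) = ?s' (i, 0) + mat c" for i
        using s[rule_format, of i 0]
        by (intro exI[of _ "s (i, 0) $ 2 $ 2"])
          (simp add: mem_UT2_trivial row_subst_def vec_eq_iff forall_2 mat_def)
    qed (use s in \<open>simp add: mem_UT2_trivial row_subst_def\<close>)
    \<comment> \<open>The (1,1) entry is a multiple of the coefficient sum, which is 0 by
      properness; the (1,2) entry is a combination of the end coefficients.\<close>
    also have "\<dots> = 0"
      using eval_row_subst_multilinear[OF ml n] eval_row_subst_proper[OF p n]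
      by (simp add: vec_eq_iff forall_2 0)
    finally show "eval_free s p = 0" .
  qed
qed

lemma end_coeffs_zero_sum:
  assumes "p \<in> proper_multilinear n" "n > 0"
  shows "end_coeffs n p \<in> zero_sum n"
proof -
  have "p \<in> multilinear n" using assms by (simp add: proper_multilinear_def)
  hence "(\<Sum>i<n. Poly_Mapping.lookup (end_coeffs n p) i) = 0"
    using eval_row_subst_multilinear assms(2) eval_row_subst_proper[OF assms] by metis
  moreover have "Poly_Mapping.keys (end_coeffs n p) \<subseteq> {..<n}"
    by (auto simp: in_keys_iff lookup_end_coeffs split: if_splits)
  ultimately show ?thesis by (simp add: zero_sum_def)
qed

lemma subspace_proper_multilinear: "pm.subspace (proper_multilinear n)"
proof -
  have "pm.subspace (Y_proper :: ('g::zero, 'a::field) free_alg set)"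
    unfolding pm.subspace_def Y_proper_def
    using unitary_subalgebra.scale[OF unitary_subalgebra.one, of 0]
    by (auto intro: unitary_subalgebra.intros)
  thus ?thesis
    unfolding proper_multilinear_def multilinear_def by (intro pm.subspace_inter pm.subspace_span)
qed

section \<open>Left-normed commutators and surjectivity onto \<open>zero_sum n\<close>\<close>

lemma Var_mult_single:
  "Var y * Poly_Mapping.single (Word w) 1 = Poly_Mapping.single (Word (y # w)) 1"
  "Poly_Mapping.single (Word w) 1 * Var y = Poly_Mapping.single (Word (w @ [y])) 1"
  by (simp_all add: Var_def mult_single plus_word_def)

text \<open>Each bracket with y turns a monomial m into my - ym, adding the letter y once to both
  terms.\<close>

lemma foldl_commutator_in_span:
  "foldl (\<lambda>p y. commutator p (Var y)) (Var x) ys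
     \<in> pm.span {Poly_Mapping.single (Word w) (1::'a::field) | w. mset w = mset (x # ys)}"
proof (induction ys rule: rev_induct)
  case Nil
  show ?case by (rule pm.span_base) (auto simp: Var_def)
next
  case (snoc y ys)
  have "commutator p (Var y)
      \<in> pm.span {Poly_Mapping.single (Word w) (1::'a) | w. mset w = mset (x # ys @ [y])}"
    if "p \<in> pm.span {Poly_Mapping.single (Word w) (1::'a) | w. mset w = mset (x # ys)}" for p
    using that
  proof (induction rule: pm.span_induct_alt)
    case base
    show ?case by (simp add: commutator_def pm.span_zero)
  next
    case (step c m q)
    then obtain w where w: "m = Poly_Mapping.single (Word w) 1" "mset w = mset (x # ys)" by blast
    have "commutator (pm_scale c m + q) (Var y) = pm_scale c (Poly_Mapping.single (Word (w @ [y])) 1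
        - Poly_Mapping.single (Word (y # w)) 1) + commutator q (Var y)"
      by (simp add: w(1) commutator_def distrib_left distrib_right pm_scale_mult_left
          pm_scale_mult_right Var_mult_single pm.scale_right_diff_distrib)
    also have "\<dots> \<in> pm.span {Poly_Mapping.single (Word w) (1::'a) | w. mset w = mset (x # ys @ [y])}"
      by (intro pm.span_add pm.span_scale pm.span_diff step pm.span_base CollectI exI conjI refl)
        (auto simp: w(2))
    finally show ?case .
  qed
  from this[OF snoc] show ?case by simp
qed

lemma foldl_commutator_multilinear:
  assumes "mset (x # ys) = mset (map (\<lambda>i. (i, h i)) [0..<n])"
  shows "foldl (\<lambda>p y. commutator p (Var y)) (Var x) ys \<in> (multilinear n :: ('g, 'a::field) free_alg set)"
proof -
  have "{Poly_Mapping.single (Word w) (1::'a) | w. mset w = mset (x # ys)}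
    \<subseteq> {Poly_Mapping.single (Word (map (\<lambda>k. (\<sigma> k, g k)) [0..<n])) 1 | \<sigma> g. \<sigma> permutes {..<n}}"
  proof clarify
    fix w assume "mset w = mset (x # ys)"
    hence "mset w = mset (map (\<lambda>i. (i, h i)) [0..<n])" using assms by simp
    then obtain \<sigma> where "\<sigma> permutes {..<length (map (\<lambda>i. (i, h i)) [0..<n])}"
      and w: "permute_list \<sigma> (map (\<lambda>i. (i, h i)) [0..<n]) = w"
      by (rule mset_eq_permutation)
    hence \<sigma>: "\<sigma> permutes {..<n}" by simp
    \<comment> \<open>In \<open>multilinear\<close> the degrees are indexed by positions, whereas
      \<open>h\<close> is indexed by variables; hence the composite with
      \<open>\<sigma>\<close>.\<close>
    have "w = map (\<lambda>k. (\<sigma> k, h (\<sigma> k))) [0..<n]"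
      using permutes_in_image[OF \<sigma>] unfolding w[symmetric] by (auto simp: permute_list_def)
    with \<sigma> show "\<exists>\<sigma> g. Poly_Mapping.single (Word w) (1::'a)
        = Poly_Mapping.single (Word (map (\<lambda>k. (\<sigma> k, g k)) [0..<n])) 1 \<and> \<sigma> permutes {..<n}"
      by (intro exI[of _ \<sigma>] exI[of _ "\<lambda>k. h (\<sigma> k)"]) simp
  qed
  from pm.span_mono[OF this] foldl_commutator_in_span[of x ys]
  show ?thesis unfolding multilinear_def by blast
qed

lemma mat_commutator_row_mat:
  "mat_commutator (row_mat a b) (row_mat c d) = row_mat 0 (a * d - c * b)"
  by (simp add: mat_commutator_def vec_eq_iff forall_2 row_mat_mult)

text \<open>The commutator \<open>[x\<^sub>i, x\<^sub>0, \<dots>]\<close> of all variables of degree \<open>0\<close> is mapped to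
  \<open>basis_diff i\<close> up to sign.\<close>

lemma basis_diff_in_image:
  assumes i: "1 \<le> i" "i < n"
  shows "(basis_diff i :: nat \<Rightarrow>\<^sub>0 'a::field) \<in> end_coeffs n ` proper_multilinear n"
proof -
  interpret e: Vector_Spaces.linear pm_scale pm_scale "end_coeffs n" by (rule end_coeffs_linear)
  \<comment> \<open>The variables other than \<open>x\<^sub>i\<close> and \<open>x\<^sub>0\<close>,
    so that each variable occurs once in the commutator.\<close>
  define r where "r = map (\<lambda>k. (k, 0::bit)) (filter (\<lambda>k. k \<noteq> 0 \<and> k \<noteq> i) [0..<n])"
  define p where "p = (foldl (\<lambda>p y. commutator p (Var y)) (Var (i, 0)) ((0, 0) # r) :: (bit, 'a) free_alg)"
  have "p \<in> commutators"
    unfolding commutators_def p_def by blast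
  hence Y: "p \<in> Y_proper"
    unfolding Y_proper_def by (intro unitary_subalgebra.gen) simp
  have "mset ((i, 0) # (0, 0) # r) = mset (map (\<lambda>k. (k, 0)) [0..<n])"
    using i by (subst set_eq_iff_mset_eq_distinct[symmetric])
      (auto simp: r_def distinct_map inj_on_def)
  hence "p \<in> multilinear n"
    unfolding p_def by (rule foldl_commutator_multilinear)
  with Y have p: "p \<in> proper_multilinear n" by (simp add: proper_multilinear_def)
  \<comment> \<open>After the first bracket the value is a multiple of
    \<open>e\<^sub>1\<^sub>2\<close>, and each further bracket with a matrix of first row (1, b)
    only changes its sign.\<close>
  have fold: "foldl (\<lambda>A y. mat_commutator A (row_subst (\<lambda>_. 1) b y)) (row_mat 0 c) r
      = row_mat 0 ((-1) ^ length r * c)" for b and c :: 'a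
  proof -
    have "\<forall>y\<in>set ys. snd y = 0 \<Longrightarrow> foldl (\<lambda>A y. mat_commutator A (row_subst (\<lambda>_. 1) b y)) (row_mat 0 c) ys
      = row_mat 0 ((-1) ^ length ys * c)" for ys
      by (induction ys arbitrary: c) (auto simp: row_subst_def mat_commutator_row_mat)
    thus ?thesis by (simp add: r_def)
  qed
  have ev: "eval_free (row_subst (\<lambda>_. 1) b) p $ 1 $ 2 = (-1) ^ length r * (b 0 - b i)" for b
    by (simp add: p_def eval_free_foldl_commutator eval_free_commutator eval_free_Var)
       (simp add: row_subst_def mat_commutator_row_mat fold[unfolded row_subst_def])
  \<comment> \<open>The extra sign in \<open>Suc\<close> comes from the first bracket, whose entry
    is \<open>b 0 - b i\<close>. As c is its own inverse, scaling by c removes the sign.\<close>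
  define c :: 'a where "c = (-1) ^ Suc (length r)"
  have cc: "c * c = 1" by (simp add: c_def flip: power_mult_distrib)
  have "end_coeffs n p = pm_scale c (basis_diff i)"
    using i ev by (intro poly_mapping_eqI)
      (auto simp: c_def lookup_end_coeffs lookup_pm_scale basis_diff_def lookup_minus lookup_single
        when_def simp del: single_one)
  hence "end_coeffs n (pm_scale c p) = basis_diff i"
    by (simp add: e.scale cc)
  moreover have "pm_scale c p \<in> proper_multilinear n"
    by (rule pm.subspace_scale[OF subspace_proper_multilinear p])
  ultimately show ?thesis by (metis imageI)
qed

lemma end_coeffs_image:
  assumes "n > 0"
  shows "end_coeffs n ` proper_multilinear n = zero_sum n"
proof
  interpret e: Vector_Spaces.linear pm_scale pm_scale "end_coeffs n" by (rule end_coeffs_linear)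
  show "end_coeffs n ` proper_multilinear n \<subseteq> zero_sum n"
    using end_coeffs_zero_sum assms by blast
  show "zero_sum n \<subseteq> end_coeffs n ` proper_multilinear n"
    by (intro zero_sum_subset e.subspace_image subspace_proper_multilinear basis_diff_in_image)
qed

section \<open>Equivariance and the resulting cocharacter and codimension\<close>

lemma perm_act_linear: "pm_linear (perm_act \<sigma>)"
  unfolding perm_act_def by (rule pm_push_linear)

lemma perm_act_mult: "perm_act \<sigma> (p * q) = perm_act \<sigma> p * perm_act \<sigma> q"
  unfolding perm_act_def by (rule pm_push_mult) (simp add: plus_word_def)

lemma perm_act_Var: "perm_act \<sigma> (Var (i, g)) = Var (\<sigma> i, g)"
  by (simp add: perm_act_def Var_def pm_push_single)

text \<open>\<open>perm_act\<close> is an algebra homomorphism that preserves degrees of variables,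
  so it maps each kind of generator to itself.\<close>

lemma perm_act_Y_proper:
  assumes "p \<in> Y_proper"
  shows "perm_act \<sigma> p \<in> Y_proper"
  using assms unfolding Y_proper_def
proof (induction rule: unitary_subalgebra.induct)
  interpret a: Vector_Spaces.linear pm_scale pm_scale "perm_act \<sigma> :: ('a, 'b) free_alg \<Rightarrow> _"
    by (rule perm_act_linear)
  {
    case one
    have "perm_act \<sigma> (1 :: ('a, 'b) free_alg) = 1"
      unfolding perm_act_def single_one[symmetric] pm_push_single by (simp add: zero_word_def)
    thus ?case by (simp add: unitary_subalgebra.one)
  next
    case (gen p)
    show ?case
    proof (rule unitary_subalgebra.gen, cases "p \<in> commutators")
      case True
      then obtain x ys where p: "p = foldl (\<lambda>p y. commutator p (Var y)) (Var x) ys" "ys \<noteq> []"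
        unfolding commutators_def by blast
      let ?h = "\<lambda>(i, g). (\<sigma> i, g)"
      have "perm_act \<sigma> (foldl (\<lambda>p y. commutator p (Var y)) q ys)
          = foldl (\<lambda>p y. commutator p (Var y)) (perm_act \<sigma> q) (map ?h ys)" for q :: "('a, 'b) free_alg"
        by (induction ys arbitrary: q) (auto simp: commutator_def a.diff perm_act_mult perm_act_Var)
      hence "perm_act \<sigma> p = foldl (\<lambda>p y. commutator p (Var y)) (Var (?h x)) (map ?h ys)"
        by (cases x) (simp add: p perm_act_Var)
      hence "perm_act \<sigma> p \<in> commutators" using p(2) unfolding commutators_def by blast
      thus "perm_act \<sigma> p \<in> {Var (i, g) |i g. g \<noteq> 0} \<union> commutators" by blast
    next
      case False
      with gen have "p \<in> {Var (i, g) |i g. g \<noteq> 0}" by (elim UnE) simp_all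
      then obtain i g where "p = Var (i, g)" "g \<noteq> 0" by (elim CollectE exE conjE)
      thus "perm_act \<sigma> p \<in> {Var (i, g) |i g. g \<noteq> 0} \<union> commutators"
        by (intro UnI1 CollectI exI[of _ "\<sigma> i"] exI[of _ g] conjI) (simp_all add: perm_act_Var)
    qed
  }
qed (auto simp: Vector_Spaces.linear_iff[THEN iffD1, OF perm_act_linear] perm_act_mult
      intro: unitary_subalgebra.intros)

lemma perm_act_multilinear:
  assumes \<sigma>: "\<sigma> permutes {..<n}" and p: "p \<in> multilinear n"
  shows "perm_act \<sigma> p \<in> multilinear n"
  using p
proof (induction rule: multilinear_induct)
  interpret a: Vector_Spaces.linear pm_scale pm_scale "perm_act \<sigma> :: ('a, 'b) free_alg \<Rightarrow> _"
    by (rule perm_act_linear)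
  {
    case zero
    show ?case by (simp add: a.zero multilinear_def pm.span_zero)
  next
    case (scale_add c \<tau> g q)
    have "Poly_Mapping.single (Word (map (\<lambda>k. ((\<sigma> \<circ> \<tau>) k, g k)) [0..<n])) 1
        \<in> (multilinear n :: ('a, 'b) free_alg set)"
      unfolding multilinear_def
      by (rule pm.span_base) (use permutes_compose[OF scale_add(1) \<sigma>] in blast)
    moreover have "perm_act \<sigma> (Poly_Mapping.single (Word (map (\<lambda>k. (\<tau> k, g k)) [0..<n])) 1)
        = (Poly_Mapping.single (Word (map (\<lambda>k. ((\<sigma> \<circ> \<tau>) k, g k)) [0..<n])) 1 :: ('a, 'b) free_alg)"
      by (simp add: perm_act_def pm_push_single o_def)
    ultimately show ?case
      using scale_add(2) unfolding multilinear_def by (simp add: a.add a.scale pm.span_add pm.span_scale)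
  }
qed

lemma end_coeffs_perm_act:
  assumes \<sigma>: "\<sigma> permutes {..<n}"
  shows "end_coeffs n (perm_act \<sigma> p) = pm_push \<sigma> (end_coeffs n p)"
proof (rule poly_mapping_eqI)
  fix k
  have bij: "bij \<sigma>" using \<sigma> by (rule permutes_bij)
  then obtain j where k: "k = \<sigma> j" by (metis bij_pointE)
  \<comment> \<open>Acting on p amounts to reindexing the substitution; the unit vector at
    \<open>\<sigma> j\<close> is pulled back to the one at \<open>j\<close>.\<close>
  have "(\<lambda>(i, g). row_subst (\<lambda>_. 1) (\<lambda>l. if l = \<sigma> j then 1 else 0) (\<sigma> i, g))
      = (row_subst (\<lambda>_. 1) (\<lambda>l. if l = j then 1 else 0) :: _ \<Rightarrow> 'a^2^2)"
    using bij by (auto simp: row_subst_def fun_eq_iff bij_def inj_eq)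
  thus "Poly_Mapping.lookup (end_coeffs n (perm_act \<sigma> p)) k
      = Poly_Mapping.lookup (pm_push \<sigma> (end_coeffs n p)) k"
    using permutes_in_image[OF \<sigma>, of j]
    by (simp add: k lookup_pm_push_bij[OF bij] lookup_end_coeffs eval_free_perm_act)
qed

text \<open>The trace of \<open>\<sigma>\<close> on \<open>zero_sum n\<close> in the basis
  \<open>basis_diff\<close>. It is left unevaluated, since the Specht character reduces to the same
  expression.\<close>

lemma proper_cocharacter_UT2_trivial:
  assumes \<sigma>: "\<sigma> permutes {..<n}" and n: "n > 0"
  shows "proper_cocharacter (UT2 (vector [0, 0] :: bit^2) :: bit \<Rightarrow> ('a::field^2^2) set) n \<sigma>
    = (\<Sum>i\<in>{1..<n}. Poly_Mapping.lookup (pm_push \<sigma> (basis_diff i)) i)"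
proof -
  have "quot_trace (proper_multilinear n) (proper_multilinear n \<inter> graded_identities
          (UT2 (vector [0, 0] :: bit^2) :: bit \<Rightarrow> ('a::field^2^2) set)) (perm_act \<sigma>)
    = (\<Sum>i\<in>{1..<n}. Poly_Mapping.lookup (pm_push \<sigma> (basis_diff i)) i)"
  proof (rule quot_trace_pullback[OF subspace_proper_multilinear end_coeffs_linear
        end_coeffs_image[OF n] _ _ zero_sum_family perm_act_linear _ end_coeffs_perm_act[OF \<sigma>]])
    show "perm_act \<sigma> ` proper_multilinear n \<subseteq> (proper_multilinear n :: (bit, 'a) free_alg set)"
      using perm_act_multilinear[OF \<sigma>] perm_act_Y_proper by (auto simp: proper_multilinear_def)
  qed (use n in \<open>auto simp: end_coeffs_eq_0_iff pm_push_def\<close>)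
  thus ?thesis by (simp add: proper_cocharacter_def \<sigma>)
qed

lemma proper_codimension_UT2_trivial:
  assumes n: "n > 0"
  shows "proper_codimension (UT2 (vector [0, 0] :: bit^2) :: bit \<Rightarrow> ('a::field_char_0^2^2) set) n = n - 1"
proof -
  have "proper_codimension (UT2 (vector [0, 0] :: bit^2) :: bit \<Rightarrow> ('a^2^2) set) n = card {1..<n}"
    unfolding proper_codimension_def
    by (rule quot_dim_pullback[OF subspace_proper_multilinear end_coeffs_linear
        end_coeffs_image[OF n] _ _ zero_sum_family]) (use n in \<open>auto simp: end_coeffs_eq_0_iff\<close>)
  thus ?thesis by simp
qed

section \<open>The Specht module of shape (n - 1, 1)\<close>

text \<open>The second row is the single point \<open>n - 1\<close>; a permutation fixing it
  preserves its complement, the first row.\<close>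

lemma row_stabilizer_hook:
  assumes n: "n \<ge> 2"
  shows "row_stabilizer [n - 1, 1] = {p. p permutes {..<n} \<and> p (n - 1) = n - 1}"
proof -
  have t: "{tableau [n - 1, 1] 0 j |j. j < [n - 1, 1] ! 0} = {..<n - 1}"
    "{tableau [n - 1, 1] 1 j |j. j < [n - 1, 1] ! 1} = {n - 1}"
    by (auto simp: tableau_def)
  have all2: "(\<forall>i<length [n - 1, 1]. Q i) \<longleftrightarrow> Q 0 \<and> Q 1" for Q
    by (auto simp: less_2_cases_iff numeral_2_eq_2[symmetric])
  have "p ` {..<n - 1} = {..<n - 1}" if p: "p permutes {..<n}" "p (n - 1) = n - 1" for p
  proof -
    have "{..<n - 1} = {..<n} - {n - 1}" using n by auto
    thus ?thesis
      using image_set_diff[OF permutes_inj[OF p(1)], of "{..<n}" "{n - 1}"] permutes_image[OF p(1)] p(2)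
      by simp
  qed
  moreover have "sum_list [n - 1, 1] = n" using n by simp
  ultimately show ?thesis
    unfolding row_stabilizer_def all2 t by auto
qed

text \<open>The first column is {0, n - 1}, the further ones are singletons, and beyond the first
  row they are empty. Only the swap of 0 and n - 1 remains besides the identity.\<close>

lemma column_stabilizer_hook:
  assumes n: "n \<ge> 2"
  shows "column_stabilizer [n - 1, 1] = {id, Transposition.transpose 0 (n - 1)}"
proof -
  have t: "{tableau [n - 1, 1] i j |i. i < length [n - 1, 1] \<and> j < [n - 1, 1] ! i}
     = (if j = 0 then {0, n - 1} else if j < n - 1 then {j} else {})" for j
  proof -
    have ex2: "(\<exists>i. x = f i \<and> i < length [n - 1, 1] \<and> Q i) \<longleftrightarrow> x = f 0 \<and> Q 0 \<or> x = f 1 \<and> Q 1"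
      for x :: nat and f Q
      by (auto simp: less_2_cases_iff numeral_2_eq_2[symmetric])
    show ?thesis unfolding ex2 using n by (auto simp: tableau_def)
  qed
  have "q permutes {..<n} \<and> (\<forall>j. q ` (if j = 0 then {0, n - 1} else if j < n - 1 then {j} else {})
       = (if j = 0 then {0, n - 1} else if j < n - 1 then {j} else {}))
    \<longleftrightarrow> q permutes {0, n - 1}" for q
  proof
    assume q: "q permutes {..<n} \<and> (\<forall>j. q ` (if j = 0 then {0, n - 1} else if j < n - 1 then {j} else {})
       = (if j = 0 then {0, n - 1} else if j < n - 1 then {j} else {}))"
    have "q x = x" if "x \<in> {..<n} - {0, n - 1}" for x
    proof -
      have "x \<noteq> 0" "x < n - 1" using that by auto
      thus ?thesis using q[THEN conjunct2, rule_format, of x] by simp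
    qed
    with q show "q permutes {0, n - 1}" by (blast intro: permutes_superset)
  next
    assume q: "q permutes {0, n - 1}"
    have "q permutes {..<n}" by (rule permutes_subset[OF q]) (use n in auto)
    moreover have "q j = j" if "j \<noteq> 0" "j < n - 1" for j
      using q that by (simp add: permutes_def)
    ultimately show "q permutes {..<n} \<and> (\<forall>j. q ` (if j = 0 then {0, n - 1} else if j < n - 1 then {j} else {})
       = (if j = 0 then {0, n - 1} else if j < n - 1 then {j} else {}))"
      using permutes_image[OF q] by simp
  qed
  moreover have "sum_list [n - 1, 1] = n" using n by simp
  ultimately show ?thesis
    unfolding column_stabilizer_def t by (simp only: permutes_doubleton_iff) blast
qed

text \<open>A left coset of the stabilizer of the point n - 1 consists of the permutations with a
  common value at n - 1. The image of x is the combination of the coset sums in which the coset with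
  value i has coefficient \<open>x\<^sub>i\<close>.\<close>

definition coset_sums :: "nat \<Rightarrow> (nat \<Rightarrow>\<^sub>0 'a::field) \<Rightarrow> ((nat \<Rightarrow> nat) \<Rightarrow>\<^sub>0 'a)" where
  "coset_sums n x =
     (\<Sum>\<pi> | \<pi> permutes {..<n}. Poly_Mapping.single \<pi> (Poly_Mapping.lookup x (\<pi> (n - 1))))"

lemma lookup_coset_sums:
  "Poly_Mapping.lookup (coset_sums n x) \<pi>
    = (if \<pi> permutes {..<n} then Poly_Mapping.lookup x (\<pi> (n - 1)) else 0)"
  by (simp add: coset_sums_def lookup_sum lookup_single when_def finite_permutations)

lemma coset_sums_linear: "pm_linear (coset_sums n)"
  by (rule pm_linearI; rule poly_mapping_eqI)
    (simp_all add: lookup_coset_sums lookup_add lookup_pm_scale)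

lemma bij_permutes_comp: "\<sigma> permutes A \<Longrightarrow> bij ((\<circ>) \<sigma>)"
  by (rule o_bij[of "(\<circ>) (inv \<sigma>)"]) (auto simp: fun_eq_iff permutes_inverses)

text \<open>Left multiplication by \<open>\<sigma>\<close> carries the coset with value i at n - 1
  to the one with value \<open>\<sigma> i\<close>.\<close>

lemma coset_sums_equivariant:
  assumes \<sigma>: "\<sigma> permutes {..<n}"
  shows "pm_push ((\<circ>) \<sigma>) (coset_sums n x) = coset_sums n (pm_push \<sigma> x)"
proof (rule poly_mapping_eqI)
  fix \<pi> :: "nat \<Rightarrow> nat"
  define \<rho> where "\<rho> = inv \<sigma> \<circ> \<pi>"
  have \<pi>: "\<pi> = \<sigma> \<circ> \<rho>" by (simp add: \<rho>_def fun_eq_iff permutes_inverses[OF \<sigma>])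
  have "\<sigma> \<circ> \<rho> permutes {..<n} \<longleftrightarrow> \<rho> permutes {..<n}"
  proof
    assume "\<sigma> \<circ> \<rho> permutes {..<n}"
    hence "\<pi> permutes {..<n}" by (simp flip: \<pi>)
    thus "\<rho> permutes {..<n}"
      unfolding \<rho>_def by (rule permutes_compose[OF _ permutes_inv[OF \<sigma>]])
  qed (rule permutes_compose[OF _ \<sigma>])
  thus "Poly_Mapping.lookup (pm_push ((\<circ>) \<sigma>) (coset_sums n x)) \<pi>
      = Poly_Mapping.lookup (coset_sums n (pm_push \<sigma> x)) \<pi>"
    unfolding \<pi> lookup_pm_push_bij[OF bij_permutes_comp[OF \<sigma>]]
    by (simp add: lookup_coset_sums lookup_pm_push_bij[OF permutes_bij[OF \<sigma>]])
qed

text \<open>With t the swap of 0 and n - 1, the symmetrizer is (1 - t) times the sum of the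
  stabilizer of n - 1. That sum is the coset sum at n - 1, and t moves it to the coset sum at
  0.\<close>

lemma young_symmetrizer_hook:
  assumes n: "n \<ge> 2"
  shows "young_symmetrizer [n - 1, 1]
    = coset_sums n (Poly_Mapping.single (n - 1) 1 - Poly_Mapping.single 0 (1::'a::field))"
proof (rule poly_mapping_eqI)
  fix \<pi> :: "nat \<Rightarrow> nat"
  define t where "t = Transposition.transpose 0 (n - 1)"
  have t: "t permutes {..<n}" unfolding t_def by (rule permutes_swap_id) (use n in auto)
  have tt: "t \<circ> p = \<pi> \<longleftrightarrow> p = t \<circ> \<pi>" for p
    by (metis t_def comp_assoc comp_id id_comp transpose_comp_involutory)
  have "t 0 \<noteq> id 0" using n by (simp add: t_def)
  hence "id \<noteq> t" by metis
  moreover have "sign t = -1" using n by (simp add: t_def sign_swap_id)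
  ultimately have y: "young_symmetrizer [n - 1, 1]
    = (\<Sum>p | p permutes {..<n} \<and> p (n - 1) = n - 1. Poly_Mapping.single p (1::'a))
      + (\<Sum>p | p permutes {..<n} \<and> p (n - 1) = n - 1. Poly_Mapping.single (t \<circ> p) (-1))"
    unfolding young_symmetrizer_def row_stabilizer_hook[OF n] column_stabilizer_hook[OF n]
      t_def[symmetric]
    by simp
  have fin: "finite {p. p permutes {..<n} \<and> p (n - 1) = n - 1}"
    by (rule finite_subset[OF _ finite_permutations[of "{..<n}"]]) auto
  have tp: "t \<circ> \<pi> permutes {..<n} \<longleftrightarrow> \<pi> permutes {..<n}"
    using permutes_compose[OF _ t, of \<pi>] permutes_compose[OF _ t, of "t \<circ> \<pi>"] tt[of "t \<circ> \<pi>"]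
    by auto
  have t0: "t (\<pi> (n - 1)) = n - 1 \<longleftrightarrow> \<pi> (n - 1) = 0"
    by (auto simp: t_def transpose_eq_iff)
  show "Poly_Mapping.lookup (young_symmetrizer [n - 1, 1]) \<pi> = Poly_Mapping.lookup
     (coset_sums n (Poly_Mapping.single (n - 1) 1 - Poly_Mapping.single 0 (1::'a))) \<pi>"
    unfolding y using fin tp t0 n
    by (auto simp: lookup_add lookup_sum lookup_single when_def tt lookup_coset_sums lookup_minus
        simp del: single_one)
qed

text \<open>By equivariance the translates of the symmetrizer are the images of the differences of
  two distinct unit vectors, and these span \<open>zero_sum n\<close>.\<close>

lemma specht_module_hook:
  assumes n: "n \<ge> 2"
  shows "specht_module [n - 1, 1] = (coset_sums n ` zero_sum n :: ((nat \<Rightarrow> nat) \<Rightarrow>\<^sub>0 'a::field) set)"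
proof
  interpret c: Vector_Spaces.linear pm_scale pm_scale "coset_sums n :: _ \<Rightarrow> ((nat \<Rightarrow> nat) \<Rightarrow>\<^sub>0 'a)"
    by (rule coset_sums_linear)
  have sl: "sum_list [n - 1, 1] = n" using n by simp
  have gen: "pm_push ((\<circ>) \<sigma>) (young_symmetrizer [n - 1, 1])
      = coset_sums n (Poly_Mapping.single (\<sigma> (n - 1)) 1 - Poly_Mapping.single (\<sigma> 0) (1::'a))"
    if \<sigma>: "\<sigma> permutes {..<n}" for \<sigma>
  proof -
    interpret p: Vector_Spaces.linear pm_scale pm_scale "pm_push \<sigma> :: (nat \<Rightarrow>\<^sub>0 'a) \<Rightarrow> _"
      by (rule pm_push_linear)
    show ?thesis
      unfolding young_symmetrizer_hook[OF n] coset_sums_equivariant[OF \<sigma>] p.diff pm_push_single ..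
  qed
  show "specht_module [n - 1, 1] \<subseteq> (coset_sums n ` zero_sum n :: ((nat \<Rightarrow> nat) \<Rightarrow>\<^sub>0 'a) set)"
    unfolding specht_module_def sl
  proof (rule pm.span_minimal)
    show "pm.subspace (coset_sums n ` zero_sum n :: ((nat \<Rightarrow> nat) \<Rightarrow>\<^sub>0 'a) set)"
      by (rule c.subspace_image[OF subspace_zero_sum])
    show "{pm_push ((\<circ>) \<sigma>) (young_symmetrizer [n - 1, 1]) |\<sigma>. \<sigma> permutes {..<n}}
      \<subseteq> (coset_sums n ` zero_sum n :: ((nat \<Rightarrow> nat) \<Rightarrow>\<^sub>0 'a) set)"
    proof clarify
      fix \<sigma> assume \<sigma>: "\<sigma> permutes {..<n}"
      have "\<sigma> (n - 1) < n" "\<sigma> 0 < n"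
        using permutes_in_image[OF \<sigma>, of "n - 1"] permutes_in_image[OF \<sigma>, of 0] n by auto
      thus "pm_push ((\<circ>) \<sigma>) (young_symmetrizer [n - 1, 1])
          \<in> (coset_sums n ` zero_sum n :: ((nat \<Rightarrow> nat) \<Rightarrow>\<^sub>0 'a) set)"
        unfolding gen[OF \<sigma>] by (intro imageI single_diff_zero_sum)
    qed
  qed
  have "zero_sum n \<subseteq> {x. coset_sums n x \<in> (specht_module [n - 1, 1] :: ((nat \<Rightarrow> nat) \<Rightarrow>\<^sub>0 'a) set)}"
  proof (rule zero_sum_subset)
    show "pm.subspace {x. coset_sums n x \<in> (specht_module [n - 1, 1] :: ((nat \<Rightarrow> nat) \<Rightarrow>\<^sub>0 'a) set)}"
      unfolding specht_module_def by (rule c.subspace_linear_preimage[OF pm.subspace_span])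
    fix i assume i: "1 \<le> i" "i < n"
    \<comment> \<open>It sends n - 1 to i and fixes 0, so the translate is exactly the image of
      \<open>basis_diff i\<close>.\<close>
    let ?\<sigma> = "Transposition.transpose i (n - 1)"
    have \<sigma>: "?\<sigma> permutes {..<n}" by (rule permutes_swap_id) (use i in auto)
    have "?\<sigma> 0 = 0" using i n by (simp add: transpose_def)
    hence "pm_push ((\<circ>) ?\<sigma>) (young_symmetrizer [n - 1, 1]) = coset_sums n (basis_diff i :: nat \<Rightarrow>\<^sub>0 'a)"
      unfolding gen[OF \<sigma>] basis_diff_def by (simp del: single_one)
    hence "coset_sums n (basis_diff i :: nat \<Rightarrow>\<^sub>0 'a)
        \<in> {pm_push ((\<circ>) \<sigma>) (young_symmetrizer [n - 1, 1]) |\<sigma>. \<sigma> permutes {..<n}}"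
      using \<sigma> by (intro CollectI exI[of _ ?\<sigma>]) simp
    thus "basis_diff i \<in> {x. coset_sums n x \<in> (specht_module [n - 1, 1] :: ((nat \<Rightarrow> nat) \<Rightarrow>\<^sub>0 'a) set)}"
      unfolding specht_module_def sl by (simp add: pm.span_base)
  qed
  thus "(coset_sums n ` zero_sum n :: ((nat \<Rightarrow> nat) \<Rightarrow>\<^sub>0 'a) set) \<subseteq> specht_module [n - 1, 1]"
    by blast
qed

text \<open>A linear left inverse of \<open>coset_sums\<close> on \<open>zero_sum n\<close>: the
  swap of i and n - 1 represents the coset with value i at n - 1.\<close>

definition coset_coeffs :: "nat \<Rightarrow> ((nat \<Rightarrow> nat) \<Rightarrow>\<^sub>0 'a::field) \<Rightarrow> (nat \<Rightarrow>\<^sub>0 'a)" where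
  "coset_coeffs n q = (\<Sum>i<n. Poly_Mapping.single i
     (Poly_Mapping.lookup q (Transposition.transpose i (n - 1))))"

lemma lookup_coset_coeffs:
  "Poly_Mapping.lookup (coset_coeffs n q) i =
    (if i < n then Poly_Mapping.lookup q (Transposition.transpose i (n - 1)) else 0)"
  by (auto simp: coset_coeffs_def lookup_sum lookup_single when_def)

lemma coset_coeffs_linear: "pm_linear (coset_coeffs n)"
  by (rule pm_linearI; rule poly_mapping_eqI)
    (simp_all add: lookup_coset_coeffs lookup_add lookup_pm_scale)

lemma coset_coeffs_coset_sums:
  assumes x: "x \<in> zero_sum n"
  shows "coset_coeffs n (coset_sums n x) = x"
proof (rule poly_mapping_eqI)
  fix i
  have "Transposition.transpose i (n - 1) permutes {..<n}" if "i < n"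
    using that by (intro permutes_swap_id) auto
  thus "Poly_Mapping.lookup (coset_coeffs n (coset_sums n x)) i = Poly_Mapping.lookup x i"
    using x by (auto simp: lookup_coset_coeffs lookup_coset_sums zero_sum_def in_keys_iff subset_iff)
qed

text \<open>\<open>coset_coeffs\<close> is an equivariant isomorphism from the Specht module onto
  \<open>zero_sum n\<close>, so the trace is computed there.\<close>

lemma irreducible_character_hook:
  assumes \<sigma>: "\<sigma> permutes {..<n}" and n: "n \<ge> 2"
  shows "(irreducible_character [n - 1, 1] \<sigma> :: 'a::field)
    = (\<Sum>i\<in>{1..<n}. Poly_Mapping.lookup (pm_push \<sigma> (basis_diff i)) i)"
proof -
  let ?S = "specht_module [n - 1, 1] :: ((nat \<Rightarrow> nat) \<Rightarrow>\<^sub>0 'a) set"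
  interpret c: Vector_Spaces.linear pm_scale pm_scale "coset_sums n :: _ \<Rightarrow> ((nat \<Rightarrow> nat) \<Rightarrow>\<^sub>0 'a)"
    by (rule coset_sums_linear)
  interpret d: Vector_Spaces.linear pm_scale pm_scale "coset_coeffs n :: _ \<Rightarrow> (nat \<Rightarrow>\<^sub>0 'a)"
    by (rule coset_coeffs_linear)
  have "quot_trace ?S {0} (pm_push ((\<circ>) \<sigma>))
    = (\<Sum>i\<in>{1..<n}. Poly_Mapping.lookup (pm_push \<sigma> (basis_diff i)) i)"
  proof (rule quot_trace_pullback[OF _ coset_coeffs_linear _ _ _ zero_sum_family pm_push_linear])
    show "pm.subspace ?S" unfolding specht_module_def by simp
    show "coset_coeffs n ` ?S = zero_sum n"
      unfolding specht_module_hook[OF n] image_image by (simp add: coset_coeffs_coset_sums)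
    show "coset_coeffs n v = 0 \<longleftrightarrow> v \<in> {0}" if "v \<in> ?S" for v
      using that unfolding specht_module_hook[OF n]
      by (auto simp: coset_coeffs_coset_sums c.zero d.zero)
    show "{0} \<subseteq> ?S" by (simp add: specht_module_def pm.span_zero)
    show "pm_push ((\<circ>) \<sigma>) ` ?S \<subseteq> ?S"
      unfolding specht_module_hook[OF n]
      by (auto simp: coset_sums_equivariant[OF \<sigma>] pm_push_zero_sum[OF \<sigma>])
    show "coset_coeffs n (pm_push ((\<circ>) \<sigma>) v) = pm_push \<sigma> (coset_coeffs n v)" if "v \<in> ?S" for v
      using that unfolding specht_module_hook[OF n]
      by (auto simp: coset_sums_equivariant[OF \<sigma>] coset_coeffs_coset_sums pm_push_zero_sum[OF \<sigma>])
  qed (simp add: pm_push_def)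
  thus ?thesis using \<sigma> n by (simp add: irreducible_character_def)
qed

theorem theorem4p3:
  fixes n :: nat
  assumes "n \<ge> 2"
  shows "proper_cocharacter (UT2 (vector [0, 0] :: bit^2) :: bit \<Rightarrow> ('a::field_char_0^2^2) set) n
           = irreducible_character [n - 1, 1] \<and>
         proper_codimension (UT2 (vector [0, 0] :: bit^2) :: bit \<Rightarrow> ('a^2^2) set) n = n - 1"
proof
  show "proper_cocharacter (UT2 (vector [0, 0] :: bit^2) :: bit \<Rightarrow> ('a^2^2) set) n
      = irreducible_character [n - 1, 1]"
  proof
    fix \<sigma>
    show "proper_cocharacter (UT2 (vector [0, 0] :: bit^2) :: bit \<Rightarrow> ('a^2^2) set) n \<sigma>
      = irreducible_character [n - 1, 1] \<sigma>"
    proof (cases "\<sigma> permutes {..<n}")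
      case True
      thus ?thesis
        using proper_cocharacter_UT2_trivial[OF True, where 'a = 'a]
          irreducible_character_hook[OF True assms, where 'a = 'a] assms
        by simp
    next
      case False
      \<comment> \<open>Both characters are extended by 0, and the parts n - 1 and 1 sum to n, so
        they are extended from the same group.\<close>
      thus ?thesis
        using assms by (simp add: proper_cocharacter_def irreducible_character_def)
    qed
  qed
  show "proper_codimension (UT2 (vector [0, 0] :: bit^2) :: bit \<Rightarrow> ('a^2^2) set) n = n - 1"
    using assms by (intro proper_codimension_UT2_trivial) simp
qed

end
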